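(* Let $L>0$ be arbitrary but fixed. Let $\omega_0>4\pi^2/L^2$ and let $\beta_{3,0}=\beta_3(\omega_0)\in(2\omega_0,3\omega_0)$ be the unique value such that the fundamental period of the corresponding cnoidal wave is $T_{\varphi_{\omega_0}}=L$. Then: (1) There exist an interval $I(\omega_0)$ around $\omega_0$, an interval $B(\beta_{3,0})$ around $\beta_{3,0}$ and a unique smooth function $\Gamma:I(\omega_0)\to B(\beta_{3,0})$ such that $\Gamma(\omega_0)=\beta_{3,0}$ and $$\frac{4\sqrt{6}}{\sqrt{3\beta_3-3\omega+\sqrt{9\omega^2+6\omega\beta_3-3\beta_3^2}}}\,K(k)=L,$$ where $\omega\in I(\omega_0)$, $\beta_3=\Gamma(\omega)\in B(\beta_{3,0})$ and $k^2=k^2(\omega)\in(0,1)$ is given by $$k^2=\frac{3\beta_3-3\omega-\sqrt{9\omega^2+6\omega\beta_3-3\beta_3^2}}{3\beta_3-3\omega+\sqrt{9\omega^2+6\omega\beta_3-3\beta_3^2}}.$$ (2) The cnoidal wave $\varphi_\omega(\cdot;\beta_1,\beta_2,\beta_3)$ determined by $\beta_i=\beta_i(\omega)$, $i=1,2,3$ (with $\beta_3=\Gamma(\omega)$), has fundamental period $L$ and satisfies $$-\varphi_\omega''+\omega\varphi_\omega-\tfrac12\varphi_\omega^2=0.$$ Moreover, the mapping $\omega\in I(\omega_0)\mapsto\varphi_\omega\in H^n_{per}([0,L])$, $n=0,1,\ldots$, is a smooth function. (3) $I(\omega_0)$ can be chosen as $(4\pi^2/L^2,+\infty)$.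
   Context: $K(k)=\int_0^1\frac{dt}{\sqrt{(1-t^2)(1-k^2t^2)}}$ is the complete elliptic integral of the first kind, and $cn(\cdot;k)$ is the Jacobi elliptic cnoidal function of modulus $k$. $H^n_{per}([0,L])$ is the Sobolev space of order $n$ of $L$-periodic functions. Given $\omega>0$ and $\beta_3\in(2\omega,3\omega)$, put $$\beta_2=\tfrac12\left(3\omega-\beta_3+\sqrt{9\omega^2+6\omega\beta_3-3\beta_3^2}\right),\qquad \beta_1=3\omega-\beta_2-\beta_3,$$ so that $\beta_1<0<\beta_2<2\omega<\beta_3<3\omega$ and $\beta_1\beta_2+\beta_1\beta_3+\beta_2\beta_3=0$. The associated cnoidal wave is $$\varphi_\omega(x)=\varphi_\omega(x;\beta_1,\beta_2,\beta_3)=\beta_2+(\beta_3-\beta_2)\,cn^2\!\left(\sqrt{\tfrac{\beta_3-\beta_1}{12}}\,x;k\right),\qquad k^2=\frac{\beta_3-\beta_2}{\beta_3-\beta_1},$$ with fundamental period $T_{\varphi_\omega}=\frac{4\sqrt3}{\sqrt{\beta_3-\beta_1}}K(k)$. For fixed $\omega>4\pi^2/L^2$ there is a unique $\beta_3=\beta_3(\omega)\in(2\omega,3\omega)$ for which this fundamental period equals $L$. *)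

theory Defs
  imports "HOL-Analysis.Analysis"
begin

section \<open>Elliptic functions of modulus \<open>k\<close>\<close>

definition ellK :: "real \<Rightarrow> real" where
  "ellK k = (LBINT t=0..1. 1 / sqrt ((1 - t^2) * (1 - k^2 * t^2)))"

definition ellF :: "real \<Rightarrow> real \<Rightarrow> real" where
  "ellF k \<theta> = (LBINT s=0..ereal \<theta>. 1 / sqrt (1 - k^2 * (sin s)^2))"

text \<open>For \<open>0 \<le> k < 1\<close> the oriented integral \<^term>\<open>ellF k\<close> is an increasing bijection of the
  real line, so the description below denotes its inverse, the Jacobi amplitude.\<close>

definition jacobi_am :: "real \<Rightarrow> real \<Rightarrow> real" where
  "jacobi_am k u = (THE \<theta>. ellF k \<theta> = u)"

definition jacobi_cn :: "real \<Rightarrow> real \<Rightarrow> real" where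
  "jacobi_cn k u = cos (jacobi_am k u)"


section \<open>The cnoidal waves\<close>

definition beta2 :: "real \<Rightarrow> real \<Rightarrow> real" where
  "beta2 \<omega> \<beta>3 = (3*\<omega> - \<beta>3 + sqrt (9*\<omega>^2 + 6*\<omega>*\<beta>3 - 3*\<beta>3^2)) / 2"

definition beta1 :: "real \<Rightarrow> real \<Rightarrow> real" where
  "beta1 \<omega> \<beta>3 = 3*\<omega> - beta2 \<omega> \<beta>3 - \<beta>3"

definition cnoidal :: "real \<Rightarrow> real \<Rightarrow> real \<Rightarrow> real \<Rightarrow> real" where
  "cnoidal \<beta>1 \<beta>2 \<beta>3 x =
     \<beta>2 + (\<beta>3 - \<beta>2) *
       (jacobi_cn (sqrt ((\<beta>3 - \<beta>2) / (\<beta>3 - \<beta>1))) (sqrt ((\<beta>3 - \<beta>1) / 12) * x))^2"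

definition cnoidal_wave :: "real \<Rightarrow> real \<Rightarrow> real \<Rightarrow> real" where
  "cnoidal_wave \<omega> \<beta>3 = cnoidal (beta1 \<omega> \<beta>3) (beta2 \<omega> \<beta>3) \<beta>3"

definition fundamental_period :: "(real \<Rightarrow> real) \<Rightarrow> real \<Rightarrow> bool" where
  "fundamental_period f T \<longleftrightarrow>
     0 < T \<and> (\<forall>x. f (x + T) = f x) \<and> (\<forall>S. 0 < S \<and> S < T \<longrightarrow> \<not> (\<forall>x. f (x + S) = f x))"

definition solves_profile_equation :: "real \<Rightarrow> (real \<Rightarrow> real) \<Rightarrow> bool" where
  "solves_profile_equation \<omega> \<phi> \<longleftrightarrow>
     (\<forall>x. \<phi> field_differentiable at x \<and> deriv \<phi> field_differentiable at x \<and>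
          - deriv (deriv \<phi>) x + \<omega> * \<phi> x - 1/2 * (\<phi> x)^2 = 0)"


section \<open>The period equation and its solution branches\<close>

definition ksq :: "real \<Rightarrow> real \<Rightarrow> real" where
  "ksq \<omega> \<beta>3 =
     (3*\<beta>3 - 3*\<omega> - sqrt (9*\<omega>^2 + 6*\<omega>*\<beta>3 - 3*\<beta>3^2)) /
     (3*\<beta>3 - 3*\<omega> + sqrt (9*\<omega>^2 + 6*\<omega>*\<beta>3 - 3*\<beta>3^2))"

text \<open>The library's \<^term>\<open>sqrt\<close> is odd, hence total. For \<open>\<omega>, L > 0\<close> the conditions below nevertheless
  force \<open>2\<omega> < \<beta>3 < 3\<omega>\<close>, where all radicands are positive.\<close>

definition period_equation :: "real \<Rightarrow> real \<Rightarrow> real \<Rightarrow> bool" where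
  "period_equation L \<omega> \<beta>3 \<longleftrightarrow>
     0 < ksq \<omega> \<beta>3 \<and> ksq \<omega> \<beta>3 < 1 \<and>
     4 * sqrt 6 / sqrt (3*\<beta>3 - 3*\<omega> + sqrt (9*\<omega>^2 + 6*\<omega>*\<beta>3 - 3*\<beta>3^2))
       * ellK (sqrt (ksq \<omega> \<beta>3)) = L"

definition open_interval_around :: "real \<Rightarrow> real set \<Rightarrow> bool" where
  "open_interval_around x I \<longleftrightarrow> open I \<and> is_interval I \<and> x \<in> I"

text \<open>Only meant for open \<open>I\<close>: there the iterated total derivatives depend on the values of \<open>f\<close>
  on \<open>I\<close> alone.\<close>

definition smooth_on_open :: "real set \<Rightarrow> (real \<Rightarrow> real) \<Rightarrow> bool" where
  "smooth_on_open I f \<longleftrightarrow> (\<forall>j. \<forall>x\<in>I. (deriv ^^ j) f field_differentiable at x)"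

definition smooth_branch ::
    "real \<Rightarrow> real \<Rightarrow> real \<Rightarrow> real set \<Rightarrow> real set \<Rightarrow> (real \<Rightarrow> real) \<Rightarrow> bool" where
  "smooth_branch L \<omega>0 \<beta>30 I B \<Gamma> \<longleftrightarrow>
     smooth_on_open I \<Gamma> \<and> \<Gamma> ` I \<subseteq> B \<and> \<Gamma> \<omega>0 = \<beta>30 \<and> (\<forall>\<omega>\<in>I. period_equation L \<omega> (\<Gamma> \<omega>))"

text \<open>A function \<open>I \<rightarrow> B\<close> is represented by a total function, so uniqueness means agreement on
  \<open>I\<close>.\<close>

definition unique_smooth_branch ::
    "real \<Rightarrow> real \<Rightarrow> real \<Rightarrow> real set \<Rightarrow> real set \<Rightarrow> (real \<Rightarrow> real) \<Rightarrow> bool" where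
  "unique_smooth_branch L \<omega>0 \<beta>30 I B \<Gamma> \<longleftrightarrow>
     smooth_branch L \<omega>0 \<beta>30 I B \<Gamma> \<and>
     (\<forall>\<Delta>. smooth_branch L \<omega>0 \<beta>30 I B \<Delta> \<longrightarrow> (\<forall>\<omega>\<in>I. \<Delta> \<omega> = \<Gamma> \<omega>))"


section \<open>Periodic Sobolev spaces\<close>

definition fourier_coeff :: "real \<Rightarrow> (real \<Rightarrow> real) \<Rightarrow> int \<Rightarrow> complex" where
  "fourier_coeff L f m =
     complex_of_real (1 / L) *
     (LINT x:{0..L}|lebesgue. complex_of_real (f x) * cis (- (2 * pi * of_int m * x / L)))"

text \<open>Elements of the real space \<open>H\<^sup>n\<close> are represented by measurable functions, two of which stand
  for the same element iff they agree almost everywhere; \<open>hper_norm L n\<close> is accordingly a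
  seminorm on representatives.\<close>

definition Hper :: "real \<Rightarrow> nat \<Rightarrow> (real \<Rightarrow> real) set" where
  "Hper L n = {f. (\<forall>x. f (x + L) = f x) \<and> f \<in> borel_measurable lebesgue \<and>
     set_integrable lebesgue {0..L} (\<lambda>x. (f x)^2) \<and>
     (\<lambda>m::int. (1 + (real_of_int m)^2)^n * (cmod (fourier_coeff L f m))^2) summable_on UNIV}"

definition hper_norm :: "real \<Rightarrow> nat \<Rightarrow> (real \<Rightarrow> real) \<Rightarrow> real" where
  "hper_norm L n f =
     sqrt (L * (\<Sum>\<^sub>\<infinity>m::int. (1 + (real_of_int m)^2)^n * (cmod (fourier_coeff L f m))^2))"

text \<open>Smoothness of a curve \<open>I \<rightarrow> H\<^sup>n\<close>: \<open>D j\<close> is its \<open>j\<close>-th derivative, each one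
  being the limit in \<open>H\<^sup>n\<close> of the difference quotients of the preceding one.\<close>

definition smooth_Hper_curve ::
    "real \<Rightarrow> nat \<Rightarrow> real set \<Rightarrow> (real \<Rightarrow> real \<Rightarrow> real) \<Rightarrow> bool" where
  "smooth_Hper_curve L n I \<gamma> \<longleftrightarrow>
     (\<exists>D :: nat \<Rightarrow> real \<Rightarrow> real \<Rightarrow> real.
        (\<forall>\<omega>\<in>I. D 0 \<omega> = \<gamma> \<omega>) \<and>
        (\<forall>j. \<forall>\<omega>\<in>I. D j \<omega> \<in> Hper L n \<and>
           ((\<lambda>\<nu>. hper_norm L n (\<lambda>x. (D j \<nu> x - D j \<omega> x) / (\<nu> - \<omega>) - D (Suc j) \<omega> x))
              \<longlongrightarrow> 0) (at \<omega> within I)))"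

definition smooth_cnoidal_family :: "real \<Rightarrow> real set \<Rightarrow> (real \<Rightarrow> real) \<Rightarrow> bool" where
  "smooth_cnoidal_family L I \<Gamma> \<longleftrightarrow>
     (\<forall>\<omega>\<in>I. 2*\<omega> < \<Gamma> \<omega> \<and> \<Gamma> \<omega> < 3*\<omega> \<and>
        fundamental_period (cnoidal_wave \<omega> (\<Gamma> \<omega>)) L \<and>
        solves_profile_equation \<omega> (cnoidal_wave \<omega> (\<Gamma> \<omega>))) \<and>
     (\<forall>n. smooth_Hper_curve L n I (\<lambda>\<omega>. cnoidal_wave \<omega> (\<Gamma> \<omega>)))"

end

theory Submission
  imports Defs
begin

text \<open>With \<open>m = k\<^sup>2\<close> as parameter and \<open>d = \<beta>\<^sub>3 - \<beta>\<^sub>1\<close>, the constraints on the \<open>\<beta>\<^sub>i\<close> become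
  \<open>d sqrt (1 - m + m\<^sup>2) = 3 \<omega>\<close> and the period is \<open>2 K / sqrt (d / 12)\<close>. Hence the period equals \<open>L\<close>
  iff \<open>\<omega> = 16 K(m)\<^sup>2 sqrt (1 - m + m\<^sup>2) / L\<^sup>2\<close>. The right-hand side increases from \<open>4 pi\<^sup>2 / L\<^sup>2\<close> to
  infinity on \<open>(0, 1)\<close>, so \<open>m\<close>, and with it \<open>\<beta>\<^sub>3\<close>, is a function of \<open>\<omega>\<close> on the whole half-line.

  For smoothness, the functions of \<open>(\<omega>, x)\<close> that occur are polynomials in a family of generators
  whose partial derivatives are again such polynomials. Convergence of the difference quotients in
  \<open>H\<^sup>n\<close> then follows from uniform convergence of those of the \<open>x\<close>-derivatives, because
  \<open>\<partial>\<^sub>x\<close> multiplies the Fourier coefficients by powers of the frequency.\<close>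

section \<open>Incomplete elliptic integrals\<close>

text \<open>The period equation is solved globally, up to the inversion of one function of one
  variable, so no implicit function theorem around \<open>\<omega>0\<close> enters: the branch is
  the only solution over the whole half-line, and the local claim is a case of the global one. The
  delicate point is monotonicity. The factor \<open>sqrt (1 - m + m^2)\<close> falls for
  \<open>m < 1/2\<close>, and the derivative of the whole product vanishes at \<open>m = 0\<close>,
  so the growth of K must be estimated sharply there. Chebyshev's inequality, which is an equality
  at \<open>m = 0\<close>, does this. For smoothness the obstacle is that the frequency enters the
  amplitude through its parameter. Differentiating in it produces the variable \<open>x\<close> and
  incomplete integrals, neither of them periodic, and then integrals of ever higher index. Hence the
  generators form an infinite family without a common period, and periodicity is carried along
  separately for the wave and its derivatives.\<close>

definition ellDelta :: "real \<Rightarrow> real \<Rightarrow> real" where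
  "ellDelta m s = sqrt (1 - m * (sin s)^2)"

text \<open>The exponents are those that repeated differentiation of \<open>1 / ellDelta m s\<close>
  in \<open>m\<close> produces, up to constant factors: each derivative adds a factor
  \<open>sin\<^sup>2\<close> above and \<open>ellDelta\<^sup>2\<close> below.\<close>

definition ellG :: "nat \<Rightarrow> real \<Rightarrow> real \<Rightarrow> real" where
  "ellG n m s = sin s ^ (2*n) / ellDelta m s ^ (2*n+1)"

text \<open>\<open>ellI 0\<close> is the integral of the first kind; differentiation in \<open>m\<close> leads from \<open>ellI n\<close> to
  \<open>ellI (Suc n)\<close>, so that no integrals of the second kind are needed.\<close>

definition ellI :: "nat \<Rightarrow> real \<Rightarrow> real \<Rightarrow> real" where
  "ellI n m \<theta> = (LBINT s=0..ereal \<theta>. ellG n m s)"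

lemma ellDelta_arg_pos:
  fixes m s :: real
  assumes "m < 1" shows "0 < 1 - m * (sin s)^2"
proof -
  have "(sin s)^2 \<le> 1" using sin_cos_squared_add[of s] zero_le_power2[of "cos s"] by linarith
  then have "m * (sin s)^2 \<le> max m 0 * 1"
    by (intro mult_mono) auto
  also have "\<dots> < 1" using assms by simp
  finally show ?thesis by simp
qed

lemma ellDelta_pos: "m < 1 \<Longrightarrow> 0 < ellDelta m s"
  using ellDelta_arg_pos[of m s] by (simp add: ellDelta_def)

lemma ellDelta_neq_0: "m < 1 \<Longrightarrow> ellDelta m s \<noteq> 0"
  using ellDelta_pos[of m s] by simp

lemma ellDelta_sq: "m < 1 \<Longrightarrow> (ellDelta m s)^2 = 1 - m * (sin s)^2"
  using ellDelta_arg_pos[of m s] by (simp add: ellDelta_def)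

lemma ellDelta_le_1: "0 \<le> m \<Longrightarrow> ellDelta m s \<le> 1"
  by (simp add: ellDelta_def)

lemma ellDelta_has_real_derivative [derivative_intros]:
  assumes "(f has_real_derivative f') (at t within A)" "(g has_real_derivative g') (at t within A)" "f t < 1"
  shows "((\<lambda>t. ellDelta (f t) (g t)) has_real_derivative
     - (f' * (sin (g t))^2 / 2 + f t * sin (g t) * cos (g t) * g') / ellDelta (f t) (g t)) (at t within A)"
  unfolding ellDelta_def using ellDelta_arg_pos[OF assms(3), of "g t"]
  by (auto intro!: derivative_eq_intros assms(1,2) simp: field_simps power2_eq_square)

lemma continuous_on_ellDelta [continuous_intros]:
  "continuous_on A f \<Longrightarrow> continuous_on A g \<Longrightarrow> continuous_on A (\<lambda>t. ellDelta (f t) (g t))"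
  for f g :: "'a::t2_space \<Rightarrow> real"
  unfolding ellDelta_def by (intro continuous_intros)

lemma continuous_on_ellG [continuous_intros]:
  fixes f g :: "'a::t2_space \<Rightarrow> real"
  assumes "continuous_on A f" "continuous_on A g" "\<And>t. t \<in> A \<Longrightarrow> f t < 1"
  shows "continuous_on A (\<lambda>t. ellG n (f t) (g t))"
  unfolding ellG_def
  by (intro continuous_intros assms ballI) (simp add: assms(3) ellDelta_neq_0)

lemma continuous_on_ellG':
  assumes "m < 1" shows "continuous_on A (ellG n m)"
  using continuous_on_ellG[OF continuous_on_const continuous_on_id, of A m n] assms by simp

lemma ellI_0 [simp]: "ellI n m 0 = 0"
  by (simp add: ellI_def zero_ereal_def)

lemma ellI_eq_integral:
  assumes "m < 1" "0 \<le> \<theta>"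
  shows "ellI n m \<theta> = integral {0..\<theta>} (ellG n m)"
  unfolding ellI_def zero_ereal_def
  by (rule interval_integral_eq_integral)
     (simp_all add: assms borel_integrable_atLeastAtMost' continuous_on_ellG')

lemma ellI_eq_integral_neg:
  assumes "m < 1" "\<theta> \<le> 0"
  shows "ellI n m \<theta> = - integral {\<theta>..0} (ellG n m)"
  unfolding ellI_def zero_ereal_def
  by (subst interval_integral_endpoints_reverse, subst interval_integral_eq_integral)
     (simp_all add: assms borel_integrable_atLeastAtMost' continuous_on_ellG')

lemma ellI_deriv_amplitude:
  assumes "m < 1"
  shows "(ellI n m has_real_derivative ellG n m \<theta>) (at \<theta>)"
proof -
  \<comment> \<open>The fundamental theorem yields a derivative within a compact interval; the
    margin 1 makes \<theta> an interior point of it.\<close>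
  define R where "R = \<bar>\<theta>\<bar> + 1"
  have "((\<lambda>u. LBINT y=ereal 0..ereal u. ellG n m y) has_vector_derivative
       ellG n m \<theta>) (at \<theta> within {-R..R})"
    by (rule interval_integral_FTC2) (simp_all add: assms R_def continuous_on_ellG')
  moreover have "at \<theta> within {-R..R} = at \<theta>"
    by (rule at_within_interior) (auto simp: R_def)
  ultimately show ?thesis
    unfolding ellI_def[abs_def] zero_ereal_def has_real_derivative_iff_has_vector_derivative by simp
qed

lemma ellG_deriv_parameter:
  assumes "m < 1"
  shows "((\<lambda>m. ellG n m s) has_real_derivative (real n + 1/2) * ellG (Suc n) m s) (at m within A)"
proof -
  let ?d = "ellDelta m s"
  have d: "?d \<noteq> 0" using assms by (rule ellDelta_neq_0)
  have 1: "((\<lambda>m. inverse (ellDelta m s)) has_real_derivative (sin s)^2 / (2 * ?d^3)) (at m within A)"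
  proof -
    have "- (inverse e * (- (1 * S / 2 + z * 0) / e) * inverse e) = S / (2 * e^3)" if "e \<noteq> 0" for e S z :: real
      using that by (simp add: field_simps power3_eq_cube)
    from this[OF d, of "(sin s)^2"] show ?thesis
      using DERIV_inverse'[OF ellDelta_has_real_derivative[OF DERIV_ident DERIV_const assms] d] by metis
  qed
  have "sn * ((1 + 2 * N) * (S / (2 * e) * inverse q)) = (N + 1/2) * ((sn * S) / (q * e))"
    if "e \<noteq> 0" "q \<noteq> 0" for sn N S e q :: real using that by (simp add: field_simps)
  note alg = this[of "?d^3" "?d^(2*n)"]
  have G: "ellG (Suc n) m s = sin s ^ (2*n) * (sin s)^2 / (?d ^ (2*n) * ?d^3)"
    by (simp add: ellG_def power2_eq_square power3_eq_cube mult_ac)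
  have 2: "sin s ^ (2*n) * ((1 + 2 * real n) * ((sin s)^2 / (2 * ?d^3) * inverse (?d ^ (2*n))))
     = (real n + 1/2) * ellG (Suc n) m s"
    unfolding G by (rule alg) (use d in simp_all)
  have "((\<lambda>m. sin s ^ (2*n) * inverse (ellDelta m s) ^ Suc (2*n)) has_real_derivative
     (real n + 1/2) * ellG (Suc n) m s) (at m within A)"
    using DERIV_cmult[OF DERIV_power_Suc[OF 1, of "2*n"], of "sin s ^ (2*n)"] 2
    by (simp add: power_inverse del: power_Suc)
  also have "(\<lambda>m. sin s ^ (2*n) * inverse (ellDelta m s) ^ Suc (2*n)) = (\<lambda>m. ellG n m s)"
    by (simp add: ellG_def[abs_def] divide_inverse power_inverse del: power_Suc)
  finally show ?thesis .
qed

text \<open>Differentiation under the integral sign on a compact interval. The oriented integral is,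
  up to sign, such an integral over \<open>{0..\<theta>}\<close> or \<open>{\<theta>..0}\<close>,
  whence the two cases.\<close>

lemma ellI_deriv_parameter:
  assumes "m < 1"
  shows "((\<lambda>m. ellI n m \<theta>) has_real_derivative (real n + 1/2) * ellI (Suc n) m \<theta>) (at m)"
proof -
  have I: "((\<lambda>m. integral {a..b} (ellG n m)) has_real_derivative
      (real n + 1/2) * integral {a..b} (ellG (Suc n) m)) (at m)" for a b :: real
  proof -
    \<comment> \<open>The set \<open>{..<1}\<close> is convex, as the Leibniz rule demands, and
      open, so that the derivative within it is a full one.\<close>
    have "((\<lambda>m. integral (cbox a b) (ellG n m)) has_real_derivative
      integral (cbox a b) (\<lambda>s. (real n + 1/2) * ellG (Suc n) m s)) (at m within {..<1})"
    proof (rule leibniz_rule_field_derivative)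
      show "ellG n x integrable_on cbox a b" if "x \<in> {..<1}" for x
        using that by (intro integrable_continuous continuous_intros) auto
      show "continuous_on ({..<1} \<times> cbox a b) (\<lambda>(x, t). (real n + 1/2) * ellG (Suc n) x t)"
        unfolding case_prod_unfold by (intro continuous_intros) auto
    qed (use assms in \<open>auto intro: ellG_deriv_parameter\<close>)
    then show ?thesis
      using assms by (simp add: at_within_open[of m "{..<1}"])
  qed
  have ev: "eventually (\<lambda>m. m < 1) (nhds m)"
    using assms eventually_nhds_in_open[of "{..<1}" m] by simp
  show ?thesis
  proof (cases "0 \<le> \<theta>")
    case True
    have "((\<lambda>m. ellI n m \<theta>) has_real_derivative (real n + 1/2) * integral {0..\<theta>} (ellG (Suc n) m)) (at m)"
      by (rule DERIV_cong_ev[THEN iffD2, OF refl _ refl I[of 0 \<theta>]])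
         (use ev True in \<open>auto elim!: eventually_mono simp: ellI_eq_integral\<close>)
    then show ?thesis using True assms by (simp add: ellI_eq_integral)
  next
    case False
    have "((\<lambda>m. ellI n m \<theta>) has_real_derivative - ((real n + 1/2) * integral {\<theta>..0} (ellG (Suc n) m))) (at m)"
      by (rule DERIV_cong_ev[THEN iffD2, OF refl _ refl DERIV_minus[OF I[of \<theta> 0]]])
         (use ev False in \<open>auto elim!: eventually_mono simp: ellI_eq_integral_neg\<close>)
    then show ?thesis using False assms by (simp add: ellI_eq_integral_neg)
  qed
qed

text \<open>Two partial derivatives give joint differentiability as soon as one of them is jointly
  continuous. The one in the amplitude is the explicit \<open>ellG\<close>, whose continuity is
  visible; that of \<open>ellI\<close> only follows from this lemma.\<close>

lemma ellI_has_derivative: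
  assumes "m < 1"
  shows "((\<lambda>(m, \<theta>). ellI n m \<theta>) has_derivative
     (\<lambda>(x, y). (real n + 1/2) * ellI (Suc n) m \<theta> * x + ellG n m \<theta> * y)) (at (m, \<theta>))"
proof -
  have "((\<lambda>(m, \<theta>). ellI n m \<theta>) has_derivative
     (\<lambda>(x, y). (real n + 1/2) * ellI (Suc n) m \<theta> * x + blinfun_mult_right (ellG n m \<theta>) y))
     (at (m, \<theta>) within {..<1} \<times> UNIV)"
  proof (rule has_derivative_partialsI)
    show "((\<lambda>m. ellI n m \<theta>) has_derivative (\<lambda>x. (real n + 1/2) * ellI (Suc n) m \<theta> * x)) (at m within {..<1})"
      using ellI_deriv_parameter[OF assms] unfolding has_field_derivative_def by (rule has_derivative_at_withinI)
    show "((\<lambda>\<theta>. ellI n m \<theta>) has_derivative blinfun_apply (blinfun_mult_right (ellG n m \<theta>))) (at \<theta> within UNIV)"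
      if "m \<in> {..<1}" for m \<theta>
      using ellI_deriv_amplitude[of m n \<theta>] that by (simp add: has_field_derivative_def blinfun_mult_right.rep_eq)
    have "continuous_on ({..<1} \<times> UNIV) (\<lambda>(m, \<theta>). blinfun_mult_right (ellG n m \<theta>))"
      unfolding case_prod_unfold by (intro continuous_intros) auto
    then show "continuous (at (m, \<theta>) within {..<1} \<times> UNIV) (\<lambda>(m, \<theta>). blinfun_mult_right (ellG n m \<theta>))"
      using assms by (auto simp: continuous_on_eq_continuous_within)
  qed auto
  then show ?thesis
    using assms at_within_open[of "(m, \<theta>)" "{..<1} \<times> UNIV"]
    by (simp add: open_Times blinfun_mult_right.rep_eq)
qed

lemma ellI_chain [derivative_intros]:
  assumes "(f has_real_derivative f') (at t)" "(g has_real_derivative g') (at t)" "f t < 1"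
  shows "((\<lambda>t. ellI n (f t) (g t)) has_real_derivative
    (real n + 1/2) * ellI (Suc n) (f t) (g t) * f' + ellG n (f t) (g t) * g') (at t)"
proof -
  have "((\<lambda>t. (f t, g t)) has_derivative (\<lambda>h. (f' * h, g' * h))) (at t)"
    using assms unfolding has_field_derivative_def by (intro has_derivative_Pair)
  from has_derivative_compose[OF this ellI_has_derivative[OF assms(3), of n "g t"]]
  have "((\<lambda>t. ellI n (f t) (g t)) has_derivative
      (\<lambda>h. (real n + 1/2) * ellI (Suc n) (f t) (g t) * (f' * h) + ellG n (f t) (g t) * (g' * h))) (at t)"
    by simp
  also have "(\<lambda>h. (real n + 1/2) * ellI (Suc n) (f t) (g t) * (f' * h) + ellG n (f t) (g t) * (g' * h))
      = (*) ((real n + 1/2) * ellI (Suc n) (f t) (g t) * f' + ellG n (f t) (g t) * g')"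
    by (simp add: fun_eq_iff algebra_simps)
  finally show ?thesis unfolding has_field_derivative_def .
qed

lemma continuous_on_ellI [continuous_intros]:
  fixes f g :: "'a::t2_space \<Rightarrow> real"
  assumes "continuous_on A f" "continuous_on A g" "\<And>t. t \<in> A \<Longrightarrow> f t < 1"
  shows "continuous_on A (\<lambda>t. ellI n (f t) (g t))"
proof -
  have "isCont (\<lambda>(m, \<theta>). ellI n m \<theta>) (m, \<theta>)" if "m < 1" for m \<theta>
    using ellI_has_derivative[OF that] by (rule has_derivative_continuous)
  then have "continuous_on ({..<1} \<times> UNIV) (\<lambda>(m, \<theta>). ellI n m \<theta>)"
    by (intro continuous_at_imp_continuous_on) force
  from continuous_on_compose2[OF this, of A "\<lambda>t. (f t, g t)"] assms
  show ?thesis by (auto intro!: continuous_on_Pair)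
qed

section \<open>Monotonicity and symmetries in the amplitude; the complete integral\<close>

lemma ellI_strict_mono:
  assumes "m < 1" shows "strict_mono (ellI 0 m)"
proof (rule strict_monoI)
  fix x y :: real assume "x < y"
  have "0 < ellG 0 m z" for z
    using ellDelta_pos[OF assms, of z] by (simp add: ellG_def)
  then show "ellI 0 m x < ellI 0 m y"
    by (intro DERIV_pos_imp_increasing[OF \<open>x < y\<close>]) (blast intro: ellI_deriv_amplitude[OF assms])
qed

text \<open>The integrand is at least 1 for these parameters. This yields both the surjectivity
  behind the amplitude and the positivity of the complete integral.\<close>

lemma ellI_0_ge:
  assumes "0 \<le> m" "m < 1" "0 \<le> \<theta>" shows "\<theta> \<le> ellI 0 m \<theta>"
proof -
  have "ellI 0 m 0 - 0 \<le> ellI 0 m \<theta> - \<theta>"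
  proof (rule DERIV_nonneg_imp_nondecreasing[OF assms(3)])
    fix x
    have "((\<lambda>\<theta>. ellI 0 m \<theta> - \<theta>) has_real_derivative ellG 0 m x - 1) (at x)"
      using assms by (intro DERIV_diff ellI_deriv_amplitude DERIV_ident)
    moreover have "0 \<le> ellG 0 m x - 1"
      using assms ellDelta_le_1[of m x] ellDelta_pos[of m x] by (simp add: ellG_def)
    ultimately show "\<exists>y. ((\<lambda>\<theta>. ellI 0 m \<theta> - \<theta>) has_real_derivative y) (at x) \<and> 0 \<le> y"
      by blast
  qed
  then show ?thesis by simp
qed

text \<open>The integrand has period pi, so both sides have the same derivative in \<theta>, and
  they agree at 0. Reflection at pi/2 is treated in the same way below.\<close>

lemma ellI_add_pi:
  assumes "m < 1" shows "ellI n m (\<theta> + pi) = ellI n m \<theta> + ellI n m pi"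
proof -
  have "((\<lambda>x. ellI n m (x + pi) - ellI n m x) has_real_derivative 0) (at x)" for x
  proof -
    have "ellG n m (x + pi) = ellG n m x" by (simp add: ellG_def ellDelta_def)
    then show ?thesis
      using DERIV_diff[OF DERIV_chain2[OF ellI_deriv_amplitude[OF assms, of n "x + pi"] DERIV_add[OF DERIV_ident DERIV_const]] ellI_deriv_amplitude[OF assms, of n x]]
      by simp
  qed
  from DERIV_isconst_all[OF allI[OF this], of \<theta> 0]
  show ?thesis by simp
qed

lemma ellI_pi_minus:
  assumes "m < 1" shows "ellI n m (pi - \<theta>) = ellI n m pi - ellI n m \<theta>"
proof -
  have "((\<lambda>x. ellI n m (pi - x) + ellI n m x) has_real_derivative 0) (at x)" for x
  proof -
    have "ellG n m (pi - x) = ellG n m x" by (simp add: ellG_def ellDelta_def)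
    then show ?thesis
      using DERIV_add[OF DERIV_chain2[OF ellI_deriv_amplitude[OF assms, of n "pi - x"] DERIV_diff[OF DERIV_const DERIV_ident]] ellI_deriv_amplitude[OF assms, of n x]]
      by simp
  qed
  from DERIV_isconst_all[OF allI[OF this], of \<theta> 0]
  show ?thesis by simp
qed

lemma ellI_minus:
  assumes "m < 1" shows "ellI n m (-\<theta>) = - ellI n m \<theta>"
  using ellI_pi_minus[OF assms, of n "-\<theta>"] ellI_add_pi[OF assms, of n \<theta>] by (simp add: add.commute)

lemma ellI_pi:
  assumes "m < 1" shows "ellI n m pi = 2 * ellI n m (pi/2)"
  using ellI_pi_minus[OF assms, of n "pi/2"] by simp

lemma ellF_eq_ellI: "ellF k \<theta> = ellI 0 (k^2) \<theta>"
  by (simp add: ellF_def ellI_def ellG_def ellDelta_def)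

text \<open>The substitution \<open>t = sin s\<close>, in the form that
  \<open>ellI 0 (k^2) (arcsin t)\<close> is an antiderivative. The integrand blows up at
  \<open>t = 1\<close>, so the fundamental theorem is used for nonnegative functions on the open
  interval, with limits at its ends.\<close>

lemma ellK_eq_ellI:
  assumes "k^2 < 1"
  shows "ellK k = ellI 0 (k^2) (pi/2)"
proof -
  have "(LBINT t=0..1. 1 / sqrt ((1 - t^2) * (1 - k^2 * t^2))) = ellI 0 (k^2) (pi/2) - ellI 0 (k^2) 0"
  proof (rule interval_integral_FTC_nonneg(2)[where F = "\<lambda>t. ellI 0 (k^2) (arcsin t)"])
    fix x :: real assume "0 < ereal x" "ereal x < 1"
    then have x: "0 < x" "x < 1" by auto
    have p: "0 < 1 - x^2" using x by (simp add: abs_square_less_1)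
    have "k^2 * x^2 \<le> k^2 * 1" using p by (intro mult_left_mono) auto
    then have q: "0 < 1 - k^2 * x^2" using assms by simp
    show "((\<lambda>t. ellI 0 (k^2) (arcsin t)) has_real_derivative 1 / sqrt ((1 - x^2) * (1 - k^2 * x^2))) (at x)"
      using DERIV_chain2[OF ellI_deriv_amplitude[OF assms, of 0 "arcsin x"] DERIV_arcsin[of x]] x
      by (simp add: ellG_def ellDelta_def real_sqrt_mult inverse_eq_divide mult.commute)
    show "isCont (\<lambda>t. 1 / sqrt ((1 - t^2) * (1 - k^2 * t^2))) x"
      using p q by (intro continuous_intros) auto
  next
    show "AE x in lborel. 0 < ereal x \<longrightarrow> ereal x < 1 \<longrightarrow> 0 \<le> 1 / sqrt ((1 - x^2) * (1 - k^2 * x^2))"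
    proof (intro always_eventually allI impI)
      fix x :: real assume "0 < ereal x" "ereal x < 1"
      then have x: "0 < x" "x < 1" by auto
      have p: "0 < 1 - x^2" using x by (simp add: abs_square_less_1)
      have "k^2 * x^2 \<le> k^2 * 1" using p by (intro mult_left_mono) auto
      then show "0 \<le> 1 / sqrt ((1 - x^2) * (1 - k^2 * x^2))" using assms p by simp
    qed
  next
    \<comment> \<open>\<open>arcsin\<close> is continuous up to 1 although not differentiable there,
      so the limits at the ends are plain values.\<close>
    have c: "continuous_on {-1..1} (\<lambda>t. ellI 0 (k^2) (arcsin t))"
      using assms by (intro continuous_intros) auto
    have "isCont (\<lambda>t. ellI 0 (k^2) (arcsin t)) 0"
      using c by (rule continuous_on_interior) (simp add: interior_atLeastAtMost_real)
    then have "((\<lambda>t. ellI 0 (k^2) (arcsin t)) \<longlongrightarrow> ellI 0 (k^2) (arcsin 0)) (at_right 0)"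
      unfolding isCont_def by (rule filterlim_mono) (auto simp: at_le)
    then show "(((\<lambda>t. ellI 0 (k^2) (arcsin t)) \<circ> real_of_ereal) \<longlongrightarrow> ellI 0 (k^2) 0) (at_right 0)"
      unfolding zero_ereal_def ereal_tendsto_simps1(2) arcsin_0 .
    have "((\<lambda>t. ellI 0 (k^2) (arcsin t)) \<longlongrightarrow> ellI 0 (k^2) (arcsin 1)) (at 1 within {-1..1})"
      using c unfolding continuous_on_def by (rule bspec) simp
    then have "((\<lambda>t. ellI 0 (k^2) (arcsin t)) \<longlongrightarrow> ellI 0 (k^2) (arcsin 1)) (at_left 1)"
      using at_within_Icc_at_left[of "-1" "1::real"] by simp
    then show "(((\<lambda>t. ellI 0 (k^2) (arcsin t)) \<circ> real_of_ereal) \<longlongrightarrow> ellI 0 (k^2) (pi/2)) (at_left 1)"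
      unfolding one_ereal_def ereal_tendsto_simps1(1) arcsin_1 .
  qed simp
  then show ?thesis by (simp add: ellK_def)
qed

section \<open>The Jacobi amplitude\<close>

definition ell_am :: "real \<Rightarrow> real \<Rightarrow> real" where
  "ell_am m u = (THE \<theta>. ellI 0 m \<theta> = u)"

lemma jacobi_am_eq_ell_am: "jacobi_am k = ell_am (k^2)"
  by (simp add: fun_eq_iff jacobi_am_def ell_am_def ellF_eq_ellI)

lemma ell_am_ellI:
  assumes "m < 1" shows "ell_am m (ellI 0 m \<theta>) = \<theta>"
  unfolding ell_am_def
  using strict_mono_imp_inj_on[OF ellI_strict_mono[OF assms]] by (auto simp: inj_eq)

text \<open>By \<open>ellI_0_ge\<close> and oddness the values at \<open>\<bar>u\<bar>\<close> and
  \<open>-\<bar>u\<bar>\<close> enclose \<open>u\<close>.\<close>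

lemma ellI_surj:
  fixes u :: real assumes "0 \<le> m" "m < 1" shows "\<exists>\<theta>. ellI 0 m \<theta> = u"
proof -
  define R where "R = \<bar>u\<bar>"
  have c: "continuous_on {-R..R} (ellI 0 m)"
    using continuous_on_ellI[OF continuous_on_const continuous_on_id, of "{-R..R}" m 0] assms by simp
  have "R \<le> ellI 0 m R" using assms by (intro ellI_0_ge) (auto simp: R_def)
  then have "ellI 0 m (-R) \<le> u" "u \<le> ellI 0 m R"
    using assms by (auto simp: ellI_minus R_def)
  then show ?thesis using IVT'[OF _ _ _ c] by (auto simp: R_def)
qed

lemma ellI_ell_am:
  assumes "0 \<le> m" "m < 1" shows "ellI 0 m (ell_am m u) = u"
  using ellI_surj[OF assms, of u] ell_am_ellI[OF assms(2)] by metis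

text \<open>Keeping \<open>m\<close> as first component turns the inversion for each fixed
  \<open>m\<close> into the inversion of a map of the plane, so the inverse function theorem gives
  differentiability in both variables at once. The formula solves
  \<open>v = ellI 1 m a / 2 * x + y / ellDelta m a\<close> for the increment \<open>y\<close> of the
  amplitude.\<close>

lemma ell_am_has_derivative:
  fixes m u :: real
  assumes "0 < m" "m < 1"
  defines "a \<equiv> ell_am m u"
  shows "((\<lambda>(m, u). ell_am m u) has_derivative
     (\<lambda>(x, v). ellDelta m a * (v - ellI 1 m a / 2 * x))) (at (m, u))"
proof -
  define H where "H = (\<lambda>(m, \<theta>). (m, ellI 0 m \<theta>))"
  define S where "S = {0<..<1::real} \<times> (UNIV :: real set)"
  have d: "(H has_derivative (\<lambda>(x, y). (x, (real 0 + 1/2) * ellI (Suc 0) m \<theta> * x + ellG 0 m \<theta> * y))) (at (m, \<theta>))"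
    if "m < 1" for m \<theta>
    unfolding H_def case_prod_unfold
    by (intro has_derivative_Pair has_derivative_fst[OF has_derivative_ident])
       (use ellI_has_derivative[OF that, of 0 \<theta>] in \<open>simp_all add: case_prod_unfold\<close>)
  have "((\<lambda>(m, u). (m, ell_am m u)) has_derivative
     (\<lambda>(x, v). (x, ellDelta m a * (v - ellI 1 m a / 2 * x)))) (at (H (m, a)))"
  proof (rule has_derivative_inverse_strong[where S = S and f = H])
    show "open S" "(m, a) \<in> S" using assms by (auto simp: S_def open_Times)
    show "continuous_on S H"
      using has_derivative_continuous[OF d] by (intro continuous_at_imp_continuous_on) (auto simp: S_def)
    show "(case H x of (m, u) \<Rightarrow> (m, ell_am m u)) = x" if "x \<in> S" for x
      using that by (auto simp: S_def H_def ell_am_ellI)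
    show "(H has_derivative (\<lambda>(x, y). (x, (real 0 + 1/2) * ellI (Suc 0) m a * x + ellG 0 m a * y))) (at (m, a))"
      using assms by (intro d)
    show "(\<lambda>(x, y). (x, (real 0 + 1/2) * ellI (Suc 0) m a * x + ellG 0 m a * y)) \<circ>
       (\<lambda>(x, v). (x, ellDelta m a * (v - ellI 1 m a / 2 * x))) = id"
      using ellDelta_neq_0[OF assms(2), of a] by (auto simp: fun_eq_iff ellG_def)
  qed
  moreover have "H (m, a) = (m, u)"
    using assms by (simp add: H_def ellI_ell_am)
  ultimately show ?thesis
    using has_derivative_snd[of "\<lambda>(m, u). (m, ell_am m u)"] by (fastforce simp: case_prod_unfold)
qed

lemma ell_am_chain [derivative_intros]:
  assumes "(f has_real_derivative f') (at t)" "(g has_real_derivative g') (at t)" "0 < f t" "f t < 1"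
  shows "((\<lambda>t. ell_am (f t) (g t)) has_real_derivative
    ellDelta (f t) (ell_am (f t) (g t)) * (g' - ellI 1 (f t) (ell_am (f t) (g t)) / 2 * f')) (at t)"
proof -
  have "((\<lambda>t. (f t, g t)) has_derivative (\<lambda>h. (f' * h, g' * h))) (at t)"
    using assms unfolding has_field_derivative_def by (intro has_derivative_Pair)
  from has_derivative_compose[OF this ell_am_has_derivative[OF assms(3,4)]]
  have "((\<lambda>t. ell_am (f t) (g t)) has_derivative
      (\<lambda>h. ellDelta (f t) (ell_am (f t) (g t)) * (g' * h - ellI 1 (f t) (ell_am (f t) (g t)) / 2 * (f' * h)))) (at t)"
    by simp
  also have "(\<lambda>h. ellDelta (f t) (ell_am (f t) (g t)) * (g' * h - ellI 1 (f t) (ell_am (f t) (g t)) / 2 * (f' * h)))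
      = (*) (ellDelta (f t) (ell_am (f t) (g t)) * (g' - ellI 1 (f t) (ell_am (f t) (g t)) / 2 * f'))"
    by (simp add: fun_eq_iff algebra_simps)
  finally show ?thesis unfolding has_field_derivative_def .
qed

lemma continuous_on_ell_am [continuous_intros]:
  fixes f g :: "'a::t2_space \<Rightarrow> real"
  assumes "continuous_on A f" "continuous_on A g" "\<And>t. t \<in> A \<Longrightarrow> 0 < f t" "\<And>t. t \<in> A \<Longrightarrow> f t < 1"
  shows "continuous_on A (\<lambda>t. ell_am (f t) (g t))"
proof -
  have "isCont (\<lambda>(m, u). ell_am m u) (m, u)" if "0 < m" "m < 1" for m u
    using ell_am_has_derivative[OF that] by (rule has_derivative_continuous)
  then have "continuous_on ({0<..<1} \<times> UNIV) (\<lambda>(m, u). ell_am m u)"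
    by (intro continuous_at_imp_continuous_on) force
  then have "continuous_on A (\<lambda>t. case (f t, g t) of (m, u) \<Rightarrow> ell_am m u)"
    by (rule continuous_on_compose2) (use assms in \<open>auto intro: continuous_on_Pair\<close>)
  then show ?thesis by simp
qed

lemma ell_am_add_period:
  assumes "0 \<le> m" "m < 1"
  shows "ell_am m (u + 2 * ellI 0 m (pi/2)) = ell_am m u + pi"
proof -
  have "ellI 0 m (ell_am m u + pi) = u + 2 * ellI 0 m (pi/2)"
    using assms by (simp add: ellI_add_pi ellI_pi ellI_ell_am)
  then show ?thesis using ell_am_ellI[OF assms(2)] by metis
qed

lemma ell_am_0: "m < 1 \<Longrightarrow> ell_am m 0 = 0"
  using ell_am_ellI[of m 0] by simp

lemma ell_am_strict_mono:
  assumes "0 \<le> m" "m < 1" "u < v" shows "ell_am m u < ell_am m v"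
  using assms strict_mono_less[OF ellI_strict_mono[OF assms(2)], of "ell_am m u" "ell_am m v"]
  by (simp add: ellI_ell_am)

text \<open>A period \<open>S\<close> compared at \<open>x = 0\<close> forces
  \<open>cos\<^sup>2 = 1\<close> at the amplitude of \<open>c * S\<close>. The amplitude increases
  from 0 to pi while its argument runs from 0 to 2 K, so a smaller \<open>S\<close> would have
  nonzero sine there.\<close>

lemma fundamental_period_cos_sq_ell_am:
  assumes "0 \<le> m" "m < 1" "0 < c" "b \<noteq> 0"
  shows "fundamental_period (\<lambda>x. a + b * (cos (ell_am m (c * x)))^2) (2 * ellI 0 m (pi/2) / c)"
  unfolding fundamental_period_def
proof (intro conjI allI impI notI)
  let ?K = "ellI 0 m (pi/2)"
  have K: "0 < ?K" using ellI_0_ge[OF assms(1,2), of "pi/2"] pi_gt_zero by linarith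
  show "0 < 2 * ?K / c" using K assms by simp
  show "a + b * (cos (ell_am m (c * (x + 2 * ?K / c))))^2 = a + b * (cos (ell_am m (c * x)))^2" for x
    using ell_am_add_period[OF assms(1,2), of "c * x"] assms by (simp add: distrib_left)
  fix S assume S: "0 < S \<and> S < 2 * ?K / c"
    and per: "\<forall>x. a + b * (cos (ell_am m (c * (x + S))))^2 = a + b * (cos (ell_am m (c * x)))^2"
  have "0 < c * S" "c * S < 2 * ?K" using S assms by (auto simp: field_simps)
  then have "0 < ell_am m (c * S)" "ell_am m (c * S) < pi"
    using ell_am_strict_mono[OF assms(1,2), of 0 "c * S"] ell_am_strict_mono[OF assms(1,2), of "c * S" "2 * ?K"]
      ell_am_add_period[OF assms(1,2), of 0] assms by (simp_all add: ell_am_0)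
  then have "0 < sin (ell_am m (c * S))" by (rule sin_gt_zero)
  moreover have "(cos (ell_am m (c * S)))^2 = 1"
    using spec[OF per, of 0] assms by (simp add: ell_am_0)
  ultimately show False using sin_cos_squared_add[of "ell_am m (c * S)"] by simp
qed

lemma fundamental_period_unique:
  "fundamental_period f S \<Longrightarrow> fundamental_period f T \<Longrightarrow> S = T"
  unfolding fundamental_period_def by (metis linorder_neqE_linordered_idom)

section \<open>The wave frequency as a function of the parameter\<close>

definition wave_r :: "real \<Rightarrow> real" where
  "wave_r m = sqrt (1 - m + m^2)"

definition wave_freq :: "real \<Rightarrow> real \<Rightarrow> real" where
  "wave_freq L m = 16 / L^2 * (ellI 0 m (pi/2))^2 * wave_r m"

text \<open>The derivative of \<open>wave_freq L\<close>, from K' =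
  \<open>ellI 1 m (pi/2) / 2\<close>. It is written as a polynomial in functions that are later
  taken as generators, \<open>inverse (wave_r m)\<close> among them.\<close>

definition wave_freq' :: "real \<Rightarrow> real \<Rightarrow> real" where
  "wave_freq' L m = 16 / L^2 * (ellI 0 m (pi/2) * ellI 1 m (pi/2) * wave_r m
     + (ellI 0 m (pi/2))^2 * (2 * m - 1) / 2 * inverse (wave_r m))"

lemma wave_r_arg_pos: "0 < 1 - m + m^2" for m :: real
proof -
  have "1 - m + m^2 = (m - 1/2)^2 + 3/4" by (simp add: power2_eq_square algebra_simps)
  then show ?thesis using zero_le_power2[of "m - 1/2"] by linarith
qed

lemma wave_r_pos: "0 < wave_r m"
  using wave_r_arg_pos by (simp add: wave_r_def)

lemma wave_r_neq_0: "wave_r m \<noteq> 0"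
  using wave_r_pos[of m] by simp

lemma wave_r_sq: "(wave_r m)^2 = 1 - m + m^2"
  using wave_r_arg_pos[of m] by (simp add: wave_r_def)

lemma wave_r_chain:
  assumes "(f has_real_derivative f') (at t)"
  shows "((\<lambda>t. wave_r (f t)) has_real_derivative (2 * f t - 1) / 2 * inverse (wave_r (f t)) * f') (at t)"
proof -
  have "((\<lambda>m. sqrt (1 - m + m^2)) has_real_derivative (2 * m - 1) / 2 * inverse (sqrt (1 - m + m^2))) (at m)" for m
    using wave_r_arg_pos[of m] by (auto intro!: derivative_eq_intros simp: field_simps)
  from DERIV_chain2[OF this assms] show ?thesis by (simp add: wave_r_def)
qed

lemma continuous_on_wave_r [continuous_intros]:
  "continuous_on A f \<Longrightarrow> continuous_on A (\<lambda>t. wave_r (f t))"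
  unfolding wave_r_def by (intro continuous_intros)

section \<open>Monotonicity and range of the frequency\<close>

lemma ellI_complete_ge:
  assumes "0 \<le> m" "m < 1" shows "pi/2 \<le> ellI 0 m (pi/2)"
  using assms by (intro ellI_0_ge) auto

lemma ellI_complete_pos:
  assumes "0 \<le> m" "m < 1" shows "0 < ellI 0 m (pi/2)"
  using ellI_complete_ge[OF assms] pi_gt_zero by linarith

lemma has_integral_ellG:
  assumes "m < 1" "0 \<le> \<theta>"
  shows "(ellG n m has_integral ellI n m \<theta>) {0..\<theta>}"
  using integrable_integral[OF integrable_continuous_real[OF continuous_on_ellG'[OF assms(1)]]] assms
  by (simp add: ellI_eq_integral)

text \<open>Chebyshev's correlation inequality: \<open>sin\<^sup>2\<close> and \<open>\<Delta>\<^sup>-\<^sup>3\<close> are both increasing on \<open>[0, pi/2]\<close>.\<close>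

lemma ellI_1_complete_ge:
  assumes "0 \<le> m" "m < 1"
  shows "ellI 0 m (pi/2) / 2 \<le> ellI 1 m (pi/2)"
proof -
  \<comment> \<open>The value of \<open>1 / ellDelta^3\<close> where \<open>sin\<^sup>2\<close>
    passes its mean 1/2. Replacing the decreasing or increasing side by this constant only lowers
    the product with \<open>sin\<^sup>2 - 1/2\<close>, and the latter has integral 0.\<close>
  define c where "c = 1 / (sqrt (1 - m/2))^3"
  have I: "((\<lambda>s. c * ((sin s)^2 - 1/2)) has_integral c * (- (sin (pi/2) * cos (pi/2) / 2) - - (sin 0 * cos 0 / 2))) {0..pi/2}"
  proof (intro has_integral_mult_right fundamental_theorem_of_calculus)
    fix x :: real
    have "((\<lambda>s. - (sin s * cos s / 2)) has_real_derivative - ((cos x * cos x - sin x * sin x) / 2)) (at x within {0..pi/2})"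
      by (auto intro!: derivative_eq_intros)
    moreover have "- ((cos x * cos x - sin x * sin x) / 2) = (sin x)^2 - 1/2"
      unfolding power2_eq_square[symmetric] by (simp add: cos_squared_eq field_simps)
    ultimately show "((\<lambda>s. - (sin s * cos s / 2)) has_vector_derivative (sin x)^2 - 1/2) (at x within {0..pi/2})"
      by (simp add: has_real_derivative_iff_has_vector_derivative)
  qed simp
  have J: "((\<lambda>s. ellG 1 m s - ellG 0 m s / 2) has_integral ellI 1 m (pi/2) - ellI 0 m (pi/2) / 2) {0..pi/2}"
    using assms by (intro has_integral_diff has_integral_divide has_integral_ellG) auto
  have "c * ((sin s)^2 - 1/2) \<le> ellG 1 m s - ellG 0 m s / 2" for s
  proof -
    define D where "D = ellDelta m s"
    have D: "0 < D" "D \<le> 1" "D^2 = 1 - m * (sin s)^2"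
      using assms ellDelta_pos ellDelta_le_1 ellDelta_sq by (auto simp: D_def)
    \<comment> \<open>Raises the integrand of the first kind to the weight of \<open>ellG 1\<close>,
      so that only a multiple of \<open>sin\<^sup>2 - 1/2\<close> remains.\<close>
    have "1 / D \<le> 1 / D^3"
      using D power_decreasing[of 1 3 D] by (intro divide_left_mono) auto
    then have "(sin s)^2 / D^3 - 1 / D^3 / 2 \<le> (sin s)^2 / D^3 - 1 / D / 2" by simp
    moreover have "c * ((sin s)^2 - 1/2) \<le> 1 / D^3 * ((sin s)^2 - 1/2)"
    proof (cases "(sin s)^2 \<ge> 1/2")
      case True
      have "D^2 \<le> 1 - m/2" using D True mult_left_mono[OF True assms(1)] by simp
      then have "D \<le> sqrt (1 - m/2)" by (rule real_le_rsqrt)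
      then have "c \<le> 1 / D^3" unfolding c_def using D assms by (intro divide_left_mono power_mono mult_pos_pos) auto
      then show ?thesis using True by (intro mult_right_mono) auto
    next
      case False
      have "1 - m/2 \<le> D^2" using D False mult_left_mono[of "(sin s)^2" "1/2" m] assms(1) by simp
      then have "sqrt (1 - m/2) \<le> D" using D by (intro real_le_lsqrt) auto
      moreover have "0 < sqrt (1 - m/2)" using assms by simp
      ultimately have "1 / D^3 \<le> c" unfolding c_def using D by (intro divide_left_mono power_mono mult_pos_pos zero_less_power) auto
      then show ?thesis using False by (intro mult_right_mono_neg) auto
    qed
    ultimately show ?thesis
      by (simp add: ellG_def D_def[symmetric] power3_eq_cube power2_eq_square right_diff_distrib mult.assoc)
  qed
  from has_integral_le[OF I J this] show ?thesis by simp
qed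

lemma ellI_complete_chain:
  assumes "(f has_real_derivative f') (at t)" "f t < 1"
  shows "((\<lambda>t. ellI n (f t) (pi/2)) has_real_derivative (real n + 1/2) * ellI (Suc n) (f t) (pi/2) * f') (at t)"
  using ellI_chain[OF assms(1) DERIV_const assms(2), of n "pi/2"] by simp

lemma wave_freq_deriv:
  assumes "m < 1"
  shows "(wave_freq L has_real_derivative wave_freq' L m) (at m)"
proof -
  let ?K = "ellI 0 m (pi/2)" and ?I = "ellI 1 m (pi/2)" and ?r = "wave_r m"
  have "((\<lambda>m. 16 / L^2 * ((ellI 0 m (pi/2))^2 * wave_r m)) has_real_derivative
     16 / L^2 * (?K^2 * ((2 * m - 1) / 2 * inverse ?r * 1) + (2 * ((real 0 + 1/2) * ellI (Suc 0) m (pi/2) * 1) * ?K) * ?r)) (at m)"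
    by (intro DERIV_cmult DERIV_mult' wave_r_chain DERIV_ident)
       (use DERIV_power[OF ellI_complete_chain[OF DERIV_ident assms, of 0], of 2] in \<open>simp add: algebra_simps\<close>)
  then show ?thesis
    by (simp add: wave_freq_def[abs_def] wave_freq'_def algebra_simps)
qed

text \<open>Up to the positive factor \<open>16 / L^2 * K / r\<close> the derivative is
  \<open>I * r^2 + K * (2 * m - 1) / 2\<close>. With \<open>I \<ge> K / 2\<close> this is at least
  \<open>K / 2 * (r^2 + 2 * m - 1) = K / 2 * (m + m^2)\<close>, which is 0 at \<open>m = 0\<close>,
  as is the derivative itself.\<close>

lemma wave_freq'_pos:
  assumes "0 < m" "m < 1" "L \<noteq> 0" shows "0 < wave_freq' L m"
proof -
  let ?K = "ellI 0 m (pi/2)" and ?I = "ellI 1 m (pi/2)" and ?r = "wave_r m"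
  have K: "0 < ?K" using assms by (intro ellI_complete_pos) auto
  have I: "?K / 2 \<le> ?I" using assms by (intro ellI_1_complete_ge) auto
  have r: "0 < ?r" by (rule wave_r_pos)
  have "0 < ?K / 2 * (m + m^2)" using K assms by (intro mult_pos_pos add_pos_pos) auto
  also have "\<dots> = ?K / 2 * ?r^2 + ?K * (2 * m - 1) / 2" unfolding wave_r_sq by (simp add: field_simps)
  also have "\<dots> \<le> ?I * ?r^2 + ?K * (2 * m - 1) / 2" using I by (intro add_right_mono mult_right_mono) auto
  finally have pos: "0 < ?I * ?r^2 + ?K * (2 * m - 1) / 2" .
  have "wave_freq' L m = 16 / L^2 * (?K / ?r * (?I * ?r^2 + ?K * (2 * m - 1) / 2))"
    unfolding wave_freq'_def using r by (simp add: field_simps power2_eq_square)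
  also have "\<dots> > 0" using pos K r assms by (intro mult_pos_pos divide_pos_pos) auto
  finally show ?thesis .
qed

text \<open>Continuity and a positive derivative in the open interval suffice, so
  \<open>a = 0\<close>, where the derivative vanishes, is covered.\<close>

lemma wave_freq_strict_mono:
  assumes "0 \<le> a" "a < b" "b < 1" "L \<noteq> 0"
  shows "wave_freq L a < wave_freq L b"
proof (rule DERIV_pos_imp_increasing_open[OF assms(2)])
  fix x assume "a < x" "x < b"
  then show "\<exists>y. (wave_freq L has_real_derivative y) (at x) \<and> 0 < y"
    using wave_freq_deriv[of x L] wave_freq'_pos[of x L] assms by auto
next
  show "continuous_on {a..b} (wave_freq L)"
    by (rule DERIV_continuous_on[of _ _ "wave_freq' L"])
       (use assms in \<open>auto intro: has_field_derivative_at_within[OF wave_freq_deriv]\<close>)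
qed

lemma ellI_parameter_0: "ellI 0 0 \<theta> = \<theta>"
proof -
  have "((\<lambda>\<theta>. ellI 0 0 \<theta> - \<theta>) has_real_derivative ellG 0 0 x - 1) (at x)" for x
    by (intro DERIV_diff ellI_deriv_amplitude DERIV_ident) simp
  then have "((\<lambda>\<theta>. ellI 0 0 \<theta> - \<theta>) has_real_derivative 0) (at x)" for x
    by (simp add: ellG_def ellDelta_def)
  from DERIV_isconst_all[OF allI[OF this], of \<theta> 0] show ?thesis by simp
qed

text \<open>The threshold of the theorem is the frequency at the degenerate parameter
  \<open>m = 0\<close>, where K is pi/2 and the wave is constant.\<close>

lemma wave_freq_0: "wave_freq L 0 = 4 * pi^2 / L^2"
  by (simp add: wave_freq_def ellI_parameter_0 wave_r_def power2_eq_square)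

text \<open>K grows logarithmically as \<open>m\<close> tends to 1. With
  \<open>e = sqrt (1 - m)\<close> and \<open>y = pi/2 - x\<close>, the square of
  \<open>ellDelta m x\<close> is \<open>cos\<^sup>2 x + e\<^sup>2 sin\<^sup>2 x\<close>, at most
  \<open>y\<^sup>2 + e\<^sup>2\<close> and so at most \<open>(e + y)\<^sup>2\<close>. The integrand
  therefore dominates \<open>1 / (e + y)\<close>, whose integral is
  \<open>ln (e + pi/2) - ln e\<close>.\<close>

lemma ellI_complete_ge_ln:
  assumes "0 \<le> m" "m < 1"
  shows "- ln (sqrt (1 - m)) \<le> ellI 0 m (pi/2)"
proof -
  define e where "e = sqrt (1 - m)"
  have e: "0 < e" "e^2 = 1 - m" using assms by (auto simp: e_def)
  have "ellI 0 m 0 + ln (e + (pi/2 - 0)) \<le> ellI 0 m (pi/2) + ln (e + (pi/2 - pi/2))"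
  proof (rule DERIV_nonneg_imp_nondecreasing[where f = "\<lambda>x. ellI 0 m x + ln (e + (pi/2 - x))"])
    fix x assume x: "0 \<le> x" "x \<le> pi/2"
    let ?y = "pi/2 - x"
    have D: "0 < ellDelta m x" using assms by (intro ellDelta_pos)
    have ey: "0 < e + ?y" using e x by simp
    have "((\<lambda>x. ellI 0 m x + ln (e + (pi/2 - x))) has_real_derivative ellG 0 m x + 1 / (e + ?y) * (0 + (0 - 1))) (at x)"
      by (intro DERIV_add DERIV_chain2[OF DERIV_ln_divide] ellI_deriv_amplitude DERIV_diff DERIV_const DERIV_ident assms ey)
    moreover have "0 \<le> ellG 0 m x + 1 / (e + ?y) * (0 + (0 - 1))"
    proof -
      have "0 \<le> cos x" "cos x \<le> ?y"
        using x sin_x_le_x[of ?y] by (auto simp: cos_sin_eq intro!: cos_ge_zero sin_ge_zero)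
      then have c: "(cos x)^2 \<le> ?y^2" by (intro power_mono)
      have s: "(1 - m) * (sin x)^2 \<le> (1 - m) * 1"
        using assms sin_cos_squared_add[of x] zero_le_power2[of "cos x"] by (intro mult_left_mono) linarith+
      have "(ellDelta m x)^2 = (cos x)^2 + (1 - m) * (sin x)^2"
        using ellDelta_sq[OF assms(2), of x] sin_cos_squared_add[of x] by (simp add: algebra_simps)
      also have "\<dots> \<le> ?y^2 + e^2" using add_mono[OF c s] e by simp
      also have "\<dots> \<le> (e + ?y)^2" using e x by (simp add: power2_sum)
      finally have "ellDelta m x \<le> e + ?y" using ey by (simp add: power2_le_iff_abs_le)
      then have "1 / (e + ?y) \<le> 1 / ellDelta m x" using D ey by (intro divide_left_mono) auto
      then show ?thesis by (simp add: ellG_def)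
    qed
    ultimately show "\<exists>y. ((\<lambda>x. ellI 0 m x + ln (e + (pi/2 - x))) has_real_derivative y) (at x) \<and> 0 \<le> y" by blast
  qed simp
  moreover have "0 \<le> ln (e + pi/2)" using e pi_gt3 by (intro ln_ge_zero) simp
  ultimately show ?thesis by (simp add: e_def)
qed

lemma wave_freq_unbounded:
  assumes "L \<noteq> 0" shows "\<exists>m. 0 < m \<and> m < 1 \<and> \<omega> \<le> wave_freq L m"
proof -
  \<comment> \<open>The summand 1 ensures that a bound of K by \<open>B\<close> from below bounds
    its square by \<open>B\<close> as well.\<close>
  define B where "B = 1 + L^2 * \<bar>\<omega>\<bar>"
  \<comment> \<open>Chosen so that \<open>sqrt (1 - m) = exp (- B)\<close>; the logarithmic bound
    then reads \<open>B \<le> K\<close>.\<close>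
  define m where "m = 1 - exp (- B)^2"
  have B: "1 \<le> B" by (simp add: B_def)
  have m: "0 < m" "m < 1"
    using B by (auto simp: m_def power2_eq_square mult_exp_exp)
  let ?K = "ellI 0 m (pi/2)"
  have "B \<le> ?K"
    using ellI_complete_ge_ln[of m] m by (simp add: m_def real_sqrt_abs)
  then have "B * 1 \<le> ?K * ?K" using B by (intro mult_mono) auto
  moreover have "1/2 \<le> wave_r m"
    unfolding wave_r_def
  proof (rule real_le_rsqrt)
    have "1 - m + m^2 = (m - 1/2)^2 + 3/4" by (simp add: power2_eq_square algebra_simps)
    then show "(1/2)^2 \<le> 1 - m + m^2" using zero_le_power2[of "m - 1/2"] by (simp add: power2_eq_square)
  qed
  ultimately have "B * (1/2) \<le> ?K^2 * wave_r m" using B by (intro mult_mono) (auto simp: power2_eq_square)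
  moreover have "L^2 * \<omega> \<le> L^2 * \<bar>\<omega>\<bar>" by (intro mult_left_mono) auto
  then have "L^2 * \<omega> \<le> B" by (simp add: B_def)
  ultimately have "L^2 * \<omega> \<le> 16 * (?K^2 * wave_r m)" using B by linarith
  then have "\<omega> \<le> wave_freq L m" using assms by (simp add: wave_freq_def field_simps)
  with m show ?thesis by blast
qed

text \<open>The inverse of \<open>wave_freq L\<close>. Despite the name its value is the parameter
  \<open>m = k\<^sup>2\<close>, not \<open>k\<close>; for frequencies that are not attained it is
  unspecified.\<close>

definition modulus :: "real \<Rightarrow> real \<Rightarrow> real" where
  "modulus L \<omega> = (THE m. 0 < m \<and> m < 1 \<and> wave_freq L m = \<omega>)"

lemma wave_freq_inj:
  assumes "0 < m" "m < 1" "0 < m'" "m' < 1" "L \<noteq> 0" "wave_freq L m = wave_freq L m'"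
  shows "m = m'"
  using wave_freq_strict_mono[of m m' L] wave_freq_strict_mono[of m' m L] assms
  by (cases m m' rule: linorder_cases) auto

lemma modulus_wave_freq:
  assumes "0 < m" "m < 1" "L \<noteq> 0"
  shows "modulus L (wave_freq L m) = m"
  unfolding modulus_def using assms by (intro the_equality) (auto dest: wave_freq_inj)

lemma modulus:
  assumes "L \<noteq> 0" "4 * pi^2 / L^2 < \<omega>"
  shows "0 < modulus L \<omega>" "modulus L \<omega> < 1" "wave_freq L (modulus L \<omega>) = \<omega>"
proof -
  obtain b where b: "0 < b" "b < 1" "\<omega> \<le> wave_freq L b"
    using wave_freq_unbounded[OF assms(1)] by blast
  have "continuous_on {0..b} (wave_freq L)"
    by (rule DERIV_continuous_on[of _ _ "wave_freq' L"])
       (use b in \<open>auto intro: has_field_derivative_at_within[OF wave_freq_deriv]\<close>)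
  then obtain m where m: "0 \<le> m" "m \<le> b" "wave_freq L m = \<omega>"
    using IVT'[of "wave_freq L" 0 \<omega> b] b assms by (auto simp: wave_freq_0)
  moreover have "m \<noteq> 0" using m assms wave_freq_0 by force
  ultimately have "0 < m" "m < 1" using b by auto
  with m assms modulus_wave_freq
  show "0 < modulus L \<omega>" "modulus L \<omega> < 1" "wave_freq L (modulus L \<omega>) = \<omega>" by auto
qed

text \<open>The inverse function theorem; \<open>wave_freq'_pos\<close> excludes a vanishing
  derivative.\<close>

lemma modulus_deriv:
  assumes "L \<noteq> 0" "4 * pi^2 / L^2 < \<omega>"
  shows "(modulus L has_real_derivative inverse (wave_freq' L (modulus L \<omega>))) (at \<omega>)"
proof -
  let ?m = "modulus L \<omega>"
  have neq: "wave_freq' L ?m \<noteq> 0"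
    using wave_freq'_pos[of ?m L] modulus[OF assms] assms(1) by simp
  have "(modulus L has_derivative (*) (inverse (wave_freq' L ?m))) (at (wave_freq L ?m))"
  proof (rule has_derivative_inverse_strong[where S = "{0<..<1}" and f = "wave_freq L" and f' = "(*) (wave_freq' L ?m)"])
    show "(wave_freq L has_derivative (*) (wave_freq' L ?m)) (at ?m)"
      using wave_freq_deriv modulus[OF assms] by (simp add: has_field_derivative_def[symmetric])
    show "continuous_on {0<..<1} (wave_freq L)"
      by (rule DERIV_continuous_on[of _ _ "wave_freq' L"])
         (auto intro: has_field_derivative_at_within[OF wave_freq_deriv])
  qed (use modulus[OF assms] assms neq in \<open>auto simp: modulus_wave_freq fun_eq_iff\<close>)
  then show ?thesis using modulus[OF assms] by (simp add: has_field_derivative_def)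
qed

section \<open>Cnoidal waves\<close>

text \<open>The difference \<open>\<beta>\<^sub>3 - \<beta>\<^sub>1\<close>.\<close>

definition wave_gap :: "real \<Rightarrow> real \<Rightarrow> real" where
  "wave_gap \<omega> \<beta> = (3*\<beta> - 3*\<omega> + sqrt (9*\<omega>^2 + 6*\<omega>*\<beta> - 3*\<beta>^2)) / 2"

text \<open>With \<open>p = 3 * \<beta> - 3 * \<omega>\<close> and the square root \<open>s\<close>,
  one has \<open>d = (p + s) / 2\<close> and \<open>m * d = (p - s) / 2\<close>, so most claims are
  linear in \<open>p\<close> and \<open>s\<close>. The quadratic one is \<open>d^2 - d * (m * d) +
  (m * d)^2 = (p^2 + 3 * s^2) / 4 = (3 * \<omega>)^2\<close>. The upper bound on \<beta> makes the
  radicand positive, the lower one gives \<open>s < p\<close>.\<close>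

lemma wave_gap_ksq:
  assumes "0 < \<omega>" "2*\<omega> < \<beta>" "\<beta> < 3*\<omega>"
  defines "d \<equiv> wave_gap \<omega> \<beta>" and "m \<equiv> ksq \<omega> \<beta>"
  shows "0 < d" "0 < m" "m < 1" "d * wave_r m = 3 * \<omega>" "\<beta> = \<omega> + d * (1 + m) / 3"
    "beta2 \<omega> \<beta> = \<omega> + d * (1 - 2 * m) / 3" "\<beta> - beta2 \<omega> \<beta> = m * d" "\<beta> - beta1 \<omega> \<beta> = d"
proof -
  define R where "R = 9*\<omega>^2 + 6*\<omega>*\<beta> - 3*\<beta>^2"
  define s where "s = sqrt R"
  define p where "p = 3*\<beta> - 3*\<omega>"
  have "R = 3 * ((3*\<omega> - \<beta>) * (\<omega> + \<beta>))" by (simp add: R_def power2_eq_square algebra_simps)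
  then have R: "0 < R" using assms by (simp add: zero_less_mult_iff)
  then have s: "0 < s" "s^2 = R" by (auto simp: s_def)
  have p: "0 < p" using assms by (simp add: p_def)
  have "p^2 - s^2 = 12 * (\<beta> * (\<beta> - 2*\<omega>))"
    unfolding s R_def p_def by (simp add: power2_eq_square algebra_simps)
  also have "\<dots> > 0" using assms by simp
  finally have sp: "s < p" using p by (intro power2_less_imp_less[of s p]) auto
  have d_eq: "d = (p + s) / 2" by (simp add: d_def wave_gap_def p_def s_def R_def)
  have m_eq: "m = (p - s) / (p + s)" by (simp add: m_def ksq_def p_def s_def R_def)
  show d: "0 < d" using p s by (simp add: d_eq)
  show m: "0 < m" "m < 1" using p s sp by (auto simp: m_eq)
  have md: "m * d = (p - s) / 2" using p s by (simp add: m_eq d_eq)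
  have "(d * wave_r m)^2 = d^2 - (m * d) * d + (m * d)^2"
    by (simp add: power_mult_distrib wave_r_sq) (simp add: power2_eq_square algebra_simps)
  also have "\<dots> = (p^2 + 3 * s^2) / 4"
    unfolding md unfolding d_eq by (simp add: power2_eq_square field_simps)
  also have "\<dots> = (3 * \<omega>)^2"
    unfolding s R_def p_def by (simp add: power2_eq_square field_simps)
  finally show "d * wave_r m = 3 * \<omega>"
    by (rule power2_eq_imp_eq) (use d wave_r_pos[of m] assms(1) in simp_all)
  have dm: "d * (1 + m) = d + m * d" "d * (1 - 2 * m) = d - 2 * (m * d)" by (simp_all add: algebra_simps)
  show "\<beta> = \<omega> + d * (1 + m) / 3" unfolding dm md unfolding d_eq p_def by (simp add: field_simps)
  have b2: "beta2 \<omega> \<beta> = (3*\<omega> - \<beta> + s) / 2" by (simp add: beta2_def s_def R_def)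
  show "beta2 \<omega> \<beta> = \<omega> + d * (1 - 2 * m) / 3"
    unfolding dm md unfolding b2 d_eq p_def by (simp add: field_simps)
  show "\<beta> - beta2 \<omega> \<beta> = m * d" unfolding md b2 p_def by (simp add: field_simps)
  show "\<beta> - beta1 \<omega> \<beta> = d" unfolding beta1_def b2 d_eq p_def by (simp add: field_simps)
qed

text \<open>As \<open>3 * \<omega> = d * r\<close>, the two bounds on \<beta> say
  \<open>r < 1 + m\<close> and \<open>1 + m < 2 * r\<close>. They hold because
  \<open>(1 + m)^2 - r^2 = 3 * m\<close> and \<open>(2 * r)^2 - (1 + m)^2 = 3 * (1 - m)^2\<close>.
  The radical collapses to \<open>d * (1 - m)\<close>.\<close>

lemma wave_gap_ksq_inverse:
  assumes "0 < \<omega>" "0 < m" "m < 1" "d * wave_r m = 3 * \<omega>"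
  defines "\<beta> \<equiv> \<omega> + d * (1 + m) / 3"
  shows "2*\<omega> < \<beta>" "\<beta> < 3*\<omega>" "ksq \<omega> \<beta> = m" "wave_gap \<omega> \<beta> = d"
proof -
  have "0 < d * wave_r m" using assms by simp
  then have d: "0 < d" using wave_r_pos[of m] by (simp add: zero_less_mult_iff)
  have "(wave_r m)^2 < (1 + m)^2"
    using assms unfolding wave_r_sq by (simp add: power2_eq_square algebra_simps)
  then have "wave_r m < 1 + m" using assms by (intro power2_less_imp_less[of "wave_r m"]) auto
  then have "d * wave_r m < d * (1 + m)" using d by (intro mult_strict_left_mono)
  then show "2*\<omega> < \<beta>" using assms by (simp add: \<beta>_def)
  have "(2 * wave_r m)^2 - (1 + m)^2 = 3 * (1 - m)^2"
    unfolding power_mult_distrib wave_r_sq by (simp add: power2_eq_square algebra_simps)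
  also have "\<dots> > 0" using assms by simp
  finally have "(1 + m)^2 < (2 * wave_r m)^2" by simp
  then have "1 + m < 2 * wave_r m"
    using wave_r_pos[of m] by (intro power2_less_imp_less[of "1 + m"]) auto
  then have "d * (1 + m) < d * (2 * wave_r m)" using d by (intro mult_strict_left_mono)
  then show "\<beta> < 3*\<omega>" using assms by (simp add: \<beta>_def)
  have w: "9 * \<omega>^2 = d^2 * (1 - m + m^2)"
    using arg_cong[OF assms(4), of "\<lambda>x. x^2"] by (simp add: power_mult_distrib wave_r_sq)
  have "9*\<omega>^2 + 6*\<omega>*\<beta> - 3*\<beta>^2 = 4 / 3 * (9 * \<omega>^2) - d^2 * (1 + m)^2 / 3"
    by (simp add: \<beta>_def power2_eq_square field_simps)
  also have "\<dots> = (d * (1 - m))^2"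
    unfolding w by (simp add: power2_eq_square field_simps)
  finally have s: "sqrt (9*\<omega>^2 + 6*\<omega>*\<beta> - 3*\<beta>^2) = d * (1 - m)"
    using d assms by simp
  show "wave_gap \<omega> \<beta> = d" unfolding wave_gap_def s by (simp add: \<beta>_def field_simps)
  have "ksq \<omega> \<beta> = (2 * d * m) / (2 * d)"
    unfolding ksq_def s by (rule arg_cong2[of _ _ _ _ "(/)"]) (simp_all add: \<beta>_def field_simps)
  then show "ksq \<omega> \<beta> = m" using d by simp
qed

text \<open>Since \<open>sqrt\<close> is odd and division by 0 gives 0, \<open>p + s \<le> 0\<close>
  would make the left side of the equation nonpositive, against \<open>0 < L\<close>. Then
  \<open>0 < k\<^sup>2 < 1\<close> means \<open>0 < s < p\<close>, the radicand is positive, and the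
  bounds follow from factoring \<open>p^2 - s^2\<close> and \<open>R\<close>. This allows uniqueness
  among all real \<beta>.\<close>

lemma period_equation_imp_range:
  assumes "0 < \<omega>" "0 < L" "period_equation L \<omega> \<beta>"
  shows "2*\<omega> < \<beta>" "\<beta> < 3*\<omega>"
proof -
  define R where "R = 9*\<omega>^2 + 6*\<omega>*\<beta> - 3*\<beta>^2"
  define s where "s = sqrt R"
  define p where "p = 3*\<beta> - 3*\<omega>"
  let ?m = "(p - s) / (p + s)"
  have m: "0 < ?m" "?m < 1" and eq: "4 * sqrt 6 / sqrt (p + s) * ellK (sqrt ?m) = L"
    using assms(3) by (simp_all add: period_equation_def ksq_def p_def s_def R_def)
  have "ellK (sqrt ?m) = ellI 0 ?m (pi/2)" using m by (simp add: ellK_eq_ellI)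
  also have "\<dots> > 0" using m by (intro ellI_complete_pos) auto
  finally have K: "0 < ellK (sqrt ?m)" .
  have "0 < 4 * sqrt 6 / sqrt (p + s)"
    using K eq assms(2) by (metis zero_less_mult_pos2)
  then have ps: "0 < p + s" by (simp add: zero_less_divide_iff)
  then have "0 < p - s" using m(1) by (simp add: zero_less_divide_iff)
  moreover have "p - s < p + s" using m(2) ps by simp
  ultimately have s: "0 < s" "s < p" by auto
  then have R: "0 < R" "s^2 = R" by (auto simp: s_def)
  have p: "0 < \<beta>" using s assms(1) by (simp add: p_def)
  have "s^2 < p^2" using s by (intro power_strict_mono) auto
  then have "0 < 12 * (\<beta> * (\<beta> - 2*\<omega>))"
    unfolding R R_def p_def by (simp add: power2_eq_square algebra_simps)
  then show "2*\<omega> < \<beta>" using p by (simp add: zero_less_mult_iff)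
  have "R = 3 * ((3*\<omega> - \<beta>) * (\<omega> + \<beta>))" by (simp add: R_def power2_eq_square algebra_simps)
  then show "\<beta> < 3*\<omega>" using R p assms(1) by (simp add: zero_less_mult_iff)
qed

lemma period_equation_iff_gap:
  assumes "0 < \<omega>" "2*\<omega> < \<beta>" "\<beta> < 3*\<omega>"
  shows "period_equation L \<omega> \<beta> \<longleftrightarrow> 2 * ellI 0 (ksq \<omega> \<beta>) (pi/2) / sqrt (wave_gap \<omega> \<beta> / 12) = L"
proof -
  note W = wave_gap_ksq[OF assms]
  let ?d = "wave_gap \<omega> \<beta>"
  have "3*\<beta> - 3*\<omega> + sqrt (9*\<omega>^2 + 6*\<omega>*\<beta> - 3*\<beta>^2) = 2 * ?d" by (simp add: wave_gap_def)
  moreover have "4 * sqrt 6 / sqrt (2 * ?d) = 2 / sqrt (?d / 12)"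
  proof -
    have "sqrt 6 = sqrt 2 * sqrt 3" "sqrt 12 = 2 * sqrt 3"
      using real_sqrt_mult[of 2 3] real_sqrt_mult[of 4 3] by simp_all
    then show ?thesis using W(1) by (simp add: real_sqrt_mult real_sqrt_divide)
  qed
  ultimately show ?thesis
    using W(2,3) by (simp add: period_equation_def ellK_eq_ellI)
qed

lemma gap_period_iff:
  assumes "0 < d" "0 < L" "0 < m" "m < 1"
  shows "2 * ellI 0 m (pi/2) / sqrt (d / 12) = L \<longleftrightarrow> d = 48 * (ellI 0 m (pi/2))^2 / L^2"
proof -
  have K: "0 < ellI 0 m (pi/2)" using assms by (intro ellI_complete_pos) auto
  have "2 * ellI 0 m (pi/2) / sqrt (d / 12) = L \<longleftrightarrow> (2 * ellI 0 m (pi/2) / sqrt (d / 12))^2 = L^2"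
    using assms K by (intro power2_eq_iff_nonneg[symmetric]) auto
  also have "(2 * ellI 0 m (pi/2) / sqrt (d / 12))^2 = 48 * (ellI 0 m (pi/2))^2 / d"
    using assms by (simp add: power_divide power_mult_distrib)
  finally show ?thesis using assms by (auto simp: field_simps)
qed

text \<open>This is \<open>\<beta>\<^sub>3 = \<omega> + d (1 + m) / 3\<close> with the value of \<open>d\<close> for which the period is \<open>L\<close>.\<close>

definition branch :: "real \<Rightarrow> real \<Rightarrow> real" where
  "branch L \<omega> = \<omega> + 48 * (ellI 0 (modulus L \<omega>) (pi/2))^2 / L^2 * (1 + modulus L \<omega>) / 3"

lemma branch:
  assumes "0 < L" "4 * pi^2 / L^2 < \<omega>"
  defines "m \<equiv> modulus L \<omega>"
  shows "2*\<omega> < branch L \<omega>" "branch L \<omega> < 3*\<omega>" "ksq \<omega> (branch L \<omega>) = m"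
    "wave_gap \<omega> (branch L \<omega>) = 48 * (ellI 0 m (pi/2))^2 / L^2"
proof -
  let ?d = "48 * (ellI 0 m (pi/2))^2 / L^2"
  have m: "0 < m" "m < 1" "wave_freq L m = \<omega>" using modulus[of L \<omega>] assms by auto
  have "0 \<le> 4 * pi^2 / L^2" by simp
  then have w: "0 < \<omega>" using assms by linarith
  have "?d * wave_r m = 3 * \<omega>"
    using m(3) by (simp add: wave_freq_def)
  from wave_gap_ksq_inverse[OF w m(1,2) this]
  show "2*\<omega> < branch L \<omega>" "branch L \<omega> < 3*\<omega>" "ksq \<omega> (branch L \<omega>) = m" "wave_gap \<omega> (branch L \<omega>) = ?d"
    by (simp_all add: branch_def m_def)
qed

text \<open>Any solution, near \<beta>30 or not, yields a parameter with frequency \<omega>.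
  Injectivity of the frequency fixes that parameter, hence \<open>d\<close>, hence \<beta>.\<close>

lemma period_equation_iff_branch:
  assumes "0 < L" "4 * pi^2 / L^2 < \<omega>"
  shows "period_equation L \<omega> \<beta> \<longleftrightarrow> \<beta> = branch L \<omega>"
proof
  have "0 \<le> 4 * pi^2 / L^2" by simp
  then have w: "0 < \<omega>" using assms by linarith
  note B = branch[OF assms]
  note m = modulus[OF _ assms(2)]
  show "period_equation L \<omega> \<beta>" if "\<beta> = branch L \<omega>"
    unfolding that period_equation_iff_gap[OF w B(1,2)] B(3,4)
    using assms(1) m ellI_complete_pos[of "modulus L \<omega>"] by (subst gap_period_iff) auto
  assume P: "period_equation L \<omega> \<beta>"
  note R = period_equation_imp_range[OF w assms(1) P]
  note W = wave_gap_ksq[OF w R]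
  have d: "wave_gap \<omega> \<beta> = 48 * (ellI 0 (ksq \<omega> \<beta>) (pi/2))^2 / L^2"
    using P gap_period_iff[OF W(1) assms(1) W(2,3)] by (simp add: period_equation_iff_gap[OF w R])
  then have "wave_freq L (ksq \<omega> \<beta>) = \<omega>"
    using W(4) by (simp add: wave_freq_def)
  then have "ksq \<omega> \<beta> = modulus L \<omega>"
    using modulus_wave_freq[OF W(2,3), of L] assms by auto
  then show "\<beta> = branch L \<omega>" using W(5) d by (simp add: branch_def)
qed

section \<open>Fundamental period and profile equation of the wave\<close>

lemma cnoidal_wave_eq:
  assumes "0 < \<omega>" "2*\<omega> < \<beta>" "\<beta> < 3*\<omega>"
  defines "d \<equiv> wave_gap \<omega> \<beta>" and "m \<equiv> ksq \<omega> \<beta>"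
  shows "cnoidal_wave \<omega> \<beta> =
    (\<lambda>x. \<omega> + d * (1 - 2 * m) / 3 + m * d * (cos (ell_am m (sqrt (d / 12) * x)))^2)"
proof -
  note W = wave_gap_ksq[OF assms(1-3), folded d_def m_def]
  have "(\<beta> - beta2 \<omega> \<beta>) / (\<beta> - beta1 \<omega> \<beta>) = m" using W(1) unfolding W(7,8) by simp
  then show ?thesis
    unfolding cnoidal_wave_def cnoidal_def fun_eq_iff
    using W(2) by (simp add: W(7,8) jacobi_cn_def jacobi_am_eq_ell_am) (simp add: W(6))
qed

lemma fundamental_period_cnoidal_wave:
  assumes "0 < \<omega>" "2*\<omega> < \<beta>" "\<beta> < 3*\<omega>"
  shows "fundamental_period (cnoidal_wave \<omega> \<beta>)
    (2 * ellI 0 (ksq \<omega> \<beta>) (pi/2) / sqrt (wave_gap \<omega> \<beta> / 12))"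
  unfolding cnoidal_wave_eq[OF assms]
  using wave_gap_ksq[OF assms] by (intro fundamental_period_cos_sq_ell_am) auto

text \<open>A function has at most one fundamental period, so \<open>L\<close> has to be the
  explicit one.\<close>

lemma fundamental_period_iff_period_equation:
  assumes "0 < \<omega>" "2*\<omega> < \<beta>" "\<beta> < 3*\<omega>"
  shows "fundamental_period (cnoidal_wave \<omega> \<beta>) L \<longleftrightarrow> period_equation L \<omega> \<beta>"
  using fundamental_period_cnoidal_wave[OF assms] fundamental_period_unique
  by (auto simp: period_equation_iff_gap[OF assms])

text \<open>Both \<open>- \<phi>''\<close> and \<open>\<omega> * \<phi> - \<phi>^2 / 2 = (\<omega>^2
  - (\<phi> - \<omega>)^2) / 2\<close> are quadratic polynomials in \<open>y = cos\<^sup>2\<close>.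
  The relation between \<open>d\<close>, \<open>m\<close> and \<omega> is what makes their constant
  terms cancel.\<close>

lemma cnoidal_profile_equation:
  assumes "0 < m" "m < 1" "0 < d" "d * wave_r m = 3 * \<omega>"
  shows "solves_profile_equation \<omega>
    (\<lambda>x. \<omega> + d * (1 - 2 * m) / 3 + m * d * (cos (ell_am m (sqrt (d / 12) * x)))^2)"
proof -
  define c where "c = sqrt (d / 12)"
  define a where "a x = ell_am m (c * x)" for x
  define \<phi> where "\<phi> x = \<omega> + d * (1 - 2 * m) / 3 + m * d * (cos (a x))^2" for x
  define \<phi>' where "\<phi>' x = - 2 * m * d * c * (cos (a x) * sin (a x) * ellDelta m (a x))" for x
  define \<phi>'' where "\<phi>'' x = - 2 * m * d * c^2 *
    (((cos (a x))^2 - (sin (a x))^2) * (ellDelta m (a x))^2 - m * (sin (a x))^2 * (cos (a x))^2)" for x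
  have c: "c^2 = d / 12" using assms by (simp add: c_def)
  have a: "(a has_real_derivative c * ellDelta m (a x)) (at x)" for x
    using ell_am_chain[OF DERIV_const DERIV_cmult_Id assms(1,2), of c x] by (simp add: a_def[abs_def] mult.commute)
  have 1: "(\<phi> has_real_derivative \<phi>' x) (at x)" for x
    unfolding \<phi>_def[abs_def] \<phi>'_def by (auto intro!: derivative_eq_intros a)
  have 2: "(\<phi>' has_real_derivative \<phi>'' x) (at x)" for x
  proof -
    have D: "ellDelta m (a x) \<noteq> 0" using assms by (intro ellDelta_neq_0)
    have "((\<lambda>x. ellDelta m (a x)) has_real_derivative - (m * sin (a x) * cos (a x) * c)) (at x)"
      using ellDelta_has_real_derivative[OF DERIV_const a assms(2), of x] D by (simp add: mult.assoc)
    from DERIV_cmult[OF DERIV_mult'[OF DERIV_mult'[OF DERIV_fun_cos[OF a] DERIV_fun_sin[OF a]] this], of "- 2 * m * d * c"]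
    show ?thesis unfolding \<phi>'_def[abs_def] \<phi>''_def
      by (rule DERIV_cong) (simp add: power2_eq_square algebra_simps)
  qed
  have d1: "deriv \<phi> = \<phi>'" using 1 by (auto intro: DERIV_imp_deriv)
  have d2: "deriv \<phi>' = \<phi>''" using 2 by (auto intro: DERIV_imp_deriv)
  have w: "\<omega>^2 = d^2 * (1 - m + m^2) / 9"
    using arg_cong[OF assms(4), of "\<lambda>x. x^2"] by (simp add: power_mult_distrib wave_r_sq)
  have "- \<phi>'' x + \<omega> * \<phi> x - 1/2 * (\<phi> x)^2 = 0" for x
  proof -
    define y where "y = (cos (a x))^2"
    have s: "(sin (a x))^2 = 1 - y" by (simp add: y_def sin_squared_eq)
    have "- \<phi>'' x = m * d^2 / 6 * (3 * m * y^2 + (2 - 4 * m) * y - (1 - m))"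
      unfolding \<phi>''_def c ellDelta_sq[OF assms(2)] s y_def[symmetric]
      by (simp add: power2_eq_square field_simps)
    moreover have "\<omega> * \<phi> x - 1/2 * (\<phi> x)^2 = (\<omega>^2 - (d * (1 - 2 * m) / 3 + m * d * y)^2) / 2"
      unfolding \<phi>_def y_def[symmetric] by (simp add: power2_eq_square field_simps)
    moreover have "(\<omega>^2 - (d * (1 - 2 * m) / 3 + m * d * y)^2) / 2
        = - (m * d^2 / 6 * (3 * m * y^2 + (2 - 4 * m) * y - (1 - m)))"
      unfolding w by (simp add: power2_eq_square field_simps)
    ultimately show ?thesis by simp
  qed
  then have "solves_profile_equation \<omega> \<phi>"
    unfolding solves_profile_equation_def d1 d2 using 1 2 by (auto simp: field_differentiable_def)
  then show ?thesis by (simp add: \<phi>_def[abs_def] a_def c_def)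
qed

lemma solves_profile_equation_cnoidal_wave:
  assumes "0 < \<omega>" "2*\<omega> < \<beta>" "\<beta> < 3*\<omega>"
  shows "solves_profile_equation \<omega> (cnoidal_wave \<omega> \<beta>)"
  unfolding cnoidal_wave_eq[OF assms]
  using wave_gap_ksq[OF assms] by (intro cnoidal_profile_equation) auto

section \<open>Fourier coefficients\<close>

lemma continuous_on_fourier_kernel [continuous_intros]:
  "continuous_on A (\<lambda>x. cis (- (2 * pi * of_int m * x / L)))"
  unfolding divide_inverse by (intro continuous_intros)

lemma absolutely_integrable_fourier:
  assumes "continuous_on {0..L} f"
  shows "set_integrable lebesgue {0..L} (\<lambda>x. complex_of_real (f x) * cis (- (2 * pi * of_int m * x / L)))"
  using assms by (intro absolutely_integrable_continuous_real continuous_intros)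

lemma fourier_coeff_eq_integral:
  assumes "continuous_on {0..L} f"
  shows "fourier_coeff L f m = of_real (1 / L) *
    integral {0..L} (\<lambda>x. of_real (f x) * cis (- (2 * pi * of_int m * x / L)))"
  unfolding fourier_coeff_def
  by (simp add: set_lebesgue_integral_eq_integral(2)[OF absolutely_integrable_fourier[OF assms]])

lemma cmod_fourier_coeff_le:
  assumes "0 < L" "continuous_on {0..L} f" "\<And>x. x \<in> {0..L} \<Longrightarrow> \<bar>f x\<bar> \<le> B"
  shows "cmod (fourier_coeff L f m) \<le> B"
proof -
  have "cmod (integral {0..L} (\<lambda>x. of_real (f x) * cis (- (2 * pi * of_int m * x / L)))) \<le> B * (L - 0)"
    using assms by (intro integral_bound) (auto intro!: continuous_intros simp: norm_mult)
  then show ?thesis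
    using assms(1) by (simp add: fourier_coeff_eq_integral[OF assms(2)] norm_mult norm_divide field_simps)
qed

lemma fourier_coeff_diff_quotient:
  assumes "continuous_on {0..L} f" "continuous_on {0..L} g" "continuous_on {0..L} h"
  shows "fourier_coeff L (\<lambda>x. (f x - g x) / c - h x) m =
    (fourier_coeff L f m - fourier_coeff L g m) / of_real c - fourier_coeff L h m"
proof -
  let ?e = "\<lambda>x. cis (- (2 * pi * of_int m * x / L))"
  have int: "(\<lambda>x. of_real (u x) * ?e x) integrable_on {0..L}" if "continuous_on {0..L} u" for u
    using that by (intro integrable_continuous_real continuous_intros)
  have "continuous_on {0..L} (\<lambda>x. (f x - g x) / c - h x)"
    using assms unfolding divide_inverse by (intro continuous_intros)
  moreover have "integral {0..L} (\<lambda>x. of_real ((f x - g x) / c - h x) * ?e x) =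
     (integral {0..L} (\<lambda>x. of_real (f x) * ?e x) - integral {0..L} (\<lambda>x. of_real (g x) * ?e x)) / of_real c
      - integral {0..L} (\<lambda>x. of_real (h x) * ?e x)"
  proof -
    have pointwise: "complex_of_real ((a - b) / c - d) * e = (of_real a * e - of_real b * e) / of_real c - of_real d * e"
      for a b d e by (simp add: diff_divide_distrib left_diff_distrib)
    have "integral {0..L} (\<lambda>x. of_real ((f x - g x) / c - h x) * ?e x) =
      integral {0..L} (\<lambda>x. (of_real (f x) * ?e x - of_real (g x) * ?e x) / of_real c - of_real (h x) * ?e x)"
      by (simp only: pointwise)
    also have "\<dots> = integral {0..L} (\<lambda>x. (of_real (f x) * ?e x - of_real (g x) * ?e x) / of_real c)
        - integral {0..L} (\<lambda>x. of_real (h x) * ?e x)"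
      using assms by (intro integral_diff integrable_on_divide integrable_diff int)
    also have "\<dots> = (integral {0..L} (\<lambda>x. of_real (f x) * ?e x) - integral {0..L} (\<lambda>x. of_real (g x) * ?e x)) / of_real c
      - integral {0..L} (\<lambda>x. of_real (h x) * ?e x)"
      using integral_diff[OF int[OF assms(1)] int[OF assms(2)]] by simp
    finally show ?thesis .
  qed
  ultimately show ?thesis
    unfolding fourier_coeff_eq_integral[OF assms(1)] fourier_coeff_eq_integral[OF assms(2)] fourier_coeff_eq_integral[OF assms(3)]
    by (simp only: fourier_coeff_eq_integral right_diff_distrib diff_divide_distrib times_divide_eq_right)
qed

definition fourier_freq :: "real \<Rightarrow> int \<Rightarrow> complex" where
  "fourier_freq L m = \<i> * of_real (2 * pi * of_int m / L)"

text \<open>Integration by parts; the boundary terms cancel because the kernel is 1 at both ends and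
  \<open>f L = f 0\<close>.\<close>

lemma fourier_coeff_deriv:
  assumes "0 < L" "\<And>x. (f has_real_derivative f' x) (at x)" "continuous_on {0..L} f'" "f L = f 0"
  shows "fourier_coeff L f' m = fourier_freq L m * fourier_coeff L f m"
proof -
  let ?e = "\<lambda>x. cis (- (2 * pi * of_int m * x / L))"
  define k where "k = - (2 * pi * of_int m / L)"
  have freq: "fourier_freq L m = - (\<i> * of_real k)" by (simp add: fourier_freq_def k_def)
  have cf: "continuous_on {0..L} f"
    by (rule DERIV_continuous_on[OF has_field_derivative_at_within[OF assms(2)]])
  have int: "(\<lambda>x. of_real (u x) * ?e x) integrable_on {0..L}" if "continuous_on {0..L} u" for u
    using that by (intro integrable_continuous_real continuous_intros)
  have "((\<lambda>x. of_real (f' x) * ?e x - fourier_freq L m * (of_real (f x) * ?e x)) has_integral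
     of_real (f L) * ?e L - of_real (f 0) * ?e 0) {0..L}"
  proof (rule fundamental_theorem_of_calculus)
    fix x assume "x \<in> {0..L}"
    have f: "((\<lambda>x. complex_of_real (f x)) has_vector_derivative of_real (f' x)) (at x within {0..L})"
      by (rule has_vector_derivative_of_real)
         (rule has_field_derivative_at_within[OF assms(2)])
    have "(\<lambda>x. - (2 * pi * of_int m * x / L)) = (*) k" by (simp add: k_def fun_eq_iff)
    then have "((\<lambda>x. - (2 * pi * of_int m * x / L)) has_real_derivative k) (at x within {0..L})"
      using DERIV_cmult_Id[of k x "{0..L}"] by simp
    then have "(?e has_vector_derivative k *\<^sub>R (\<i> * ?e x)) (at x within {0..L})"
      unfolding has_field_derivative_def has_vector_derivative_def
      by (rule has_derivative_cis[THEN has_derivative_eq_rhs]) (simp add: fun_eq_iff mult.commute)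
    from has_vector_derivative_mult[OF f this]
    show "((\<lambda>x. of_real (f x) * ?e x) has_vector_derivative
        of_real (f' x) * ?e x - fourier_freq L m * (of_real (f x) * ?e x)) (at x within {0..L})"
      by (rule has_vector_derivative_eq_rhs) (simp add: freq scaleR_conv_of_real mult.commute mult.left_commute)
  qed (use assms in simp)
  note FTC = this
  have eL: "?e L = 1"
  proof -
    have "- (2 * pi * of_int m * L / L) = 2 * pi * of_int (- m)" using assms(1) by simp
    then show ?thesis using cis_multiple_2pi[OF Ints_of_int, of "- m"] by simp
  qed
  have "((\<lambda>x. of_real (f' x) * ?e x - fourier_freq L m * (of_real (f x) * ?e x)) has_integral
      integral {0..L} (\<lambda>x. of_real (f' x) * ?e x) - fourier_freq L m * integral {0..L} (\<lambda>x. of_real (f x) * ?e x)) {0..L}"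
    by (rule has_integral_diff[OF integrable_integral[OF int[OF assms(3)]]
          has_integral_mult_right[OF integrable_integral[OF int[OF cf]]]])
  from has_integral_unique[OF FTC this] have "of_real (f L) * ?e L - of_real (f 0) * ?e 0 =
      integral {0..L} (\<lambda>x. of_real (f' x) * ?e x) - fourier_freq L m * integral {0..L} (\<lambda>x. of_real (f x) * ?e x)"
    .
  with eL assms(4)
  have "integral {0..L} (\<lambda>x. of_real (f' x) * ?e x) = fourier_freq L m * integral {0..L} (\<lambda>x. of_real (f x) * ?e x)"
    by simp
  then show ?thesis
    unfolding fourier_coeff_eq_integral[OF cf] fourier_coeff_eq_integral[OF assms(3)] by simp
qed

section \<open>Bounds for the weighted sums of Fourier coefficients\<close>

lemma summable_on_int_weight: "(\<lambda>m::int. 1 / (1 + (real_of_int m)^2)) summable_on UNIV"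
proof -
  have "summable (\<lambda>n::nat. 1 / (1 + (real n)^2))"
  proof (rule summable_comparison_test'[OF inverse_power_summable[of 2, where ?'a = real]])
    fix n :: nat assume "n \<ge> 1"
    then show "norm (1 / (1 + (real n)^2)) \<le> inverse (real n ^ 2)"
      using divide_left_mono[of "(real n)^2" "1 + (real n)^2" 1] by (simp add: inverse_eq_divide zero_less_mult_iff add_pos_pos)
  qed simp
  then have "(\<lambda>n::nat. 1 / (1 + (real n)^2)) summable_on UNIV"
    by (intro norm_summable_imp_summable_on) simp
  then have "((\<lambda>m::int. 1 / (1 + (real_of_int m)^2)) \<circ> int) summable_on UNIV"
    "((\<lambda>m::int. 1 / (1 + (real_of_int m)^2)) \<circ> (\<lambda>n. - int n)) summable_on UNIV"
    by (simp_all add: o_def)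
  then have "(\<lambda>m::int. 1 / (1 + (real_of_int m)^2)) summable_on range int"
    "(\<lambda>m::int. 1 / (1 + (real_of_int m)^2)) summable_on range (\<lambda>n. - int n)"
    by (simp_all add: summable_on_reindex inj_on_def)
  then have "(\<lambda>m::int. 1 / (1 + (real_of_int m)^2)) summable_on (range int \<union> range (\<lambda>n. - int n))"
    by (rule summable_on_union)
  moreover have "range int \<union> range (\<lambda>n. - int n) = UNIV"
    by (auto simp: image_iff) (metis int_cases2)
  ultimately show ?thesis by simp
qed

text \<open>The constant comes from \<open>(1 + t)^(n+1) \<le> 2^(n+1) * (1 + t^(n+1))\<close> with
  \<open>t = m^2\<close>; the factor \<open>L / (2 * pi)\<close> converts the integer
  \<open>m\<close> into the modulus of \<open>fourier_freq L m\<close>.\<close>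

definition hper_const :: "real \<Rightarrow> nat \<Rightarrow> real" where
  "hper_const L n = 2^(n+1) * (1 + ((L / (2*pi))^2)^(n+1))"

text \<open>One order more than \<open>n\<close> is controlled, which leaves the summable factor
  \<open>1 / (1 + m^2)\<close>. Uniform bounds on a function and its derivative of order
  \<open>n + 1\<close> thus replace Parseval's identity.\<close>

lemma fourier_weight_le:
  assumes "0 < L" "cmod z \<le> A" "cmod (fourier_freq L m ^ (n+1) * z) \<le> A"
  shows "(1 + (real_of_int m)^2)^n * (cmod z)^2 \<le> hper_const L n * A^2 * (1 / (1 + (real_of_int m)^2))"
proof -
  define t where "t = (real_of_int m)^2"
  define l where "l = L / (2*pi)"
  have t: "0 \<le> t" by (simp add: t_def)
  have l: "0 < l" using assms by (simp add: l_def)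
  have A: "0 \<le> A" using assms(2) norm_ge_zero order_trans by blast
  have fr: "cmod (fourier_freq L m) = \<bar>real_of_int m\<bar> / l"
    unfolding fourier_freq_def norm_mult norm_ii norm_of_real l_def using assms(1) by (simp add: abs_mult)
  have "(cmod (fourier_freq L m ^ (n+1) * z))^2 = (((\<bar>real_of_int m\<bar> / l)^(n+1))^2) * (cmod z)^2"
    unfolding norm_mult norm_power fr power_mult_distrib ..
  also have "((\<bar>real_of_int m\<bar> / l)^(n+1))^2 = ((\<bar>real_of_int m\<bar> / l)^2)^(n+1)"
    unfolding power_mult[symmetric] by (simp only: mult.commute)
  also have "\<dots> = t^(n+1) / (l^2)^(n+1)"
    by (simp only: power_divide power2_abs t_def)
  finally have "t^(n+1) * (cmod z)^2 = (cmod (fourier_freq L m ^ (n+1) * z))^2 * (l^2)^(n+1)"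
    using l by simp
  also have "\<dots> \<le> A^2 * (l^2)^(n+1)"
    using assms(3) l by (intro mult_right_mono power_mono) auto
  finally have 1: "t^(n+1) * (cmod z)^2 \<le> A^2 * (l^2)^(n+1)" .
  have 2: "(cmod z)^2 \<le> A^2" using assms(2) by (intro power_mono) auto
  have "(1 + t)^(n+1) \<le> (2 * max 1 t)^(n+1)" using t by (intro power_mono) auto
  also have "\<dots> \<le> 2^(n+1) * (1 + t^(n+1))"
    using t by (auto simp: power_mult_distrib max_def)
  finally have "(1 + t)^(n+1) * (cmod z)^2 \<le> 2^(n+1) * (1 + t^(n+1)) * (cmod z)^2"
    by (intro mult_right_mono) auto
  also have "\<dots> = 2^(n+1) * ((cmod z)^2 + t^(n+1) * (cmod z)^2)" by (simp add: algebra_simps)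
  also have "\<dots> \<le> 2^(n+1) * (A^2 + A^2 * (l^2)^(n+1))" using 1 2 by (intro mult_left_mono add_mono) auto
  also have "\<dots> = hper_const L n * A^2" by (simp add: hper_const_def l_def algebra_simps)
  finally have "(1 + t) * ((1 + t)^n * (cmod z)^2) \<le> hper_const L n * A^2" by (simp add: mult.assoc)
  then show ?thesis using t by (simp add: field_simps flip: t_def)
qed

text \<open>The second bound is linear in \<open>A\<close>, so the norm tends to 0 whenever the
  uniform bounds do.\<close>

lemma hper_weighted_sum:
  assumes "0 < L" "\<And>m. cmod (z m) \<le> A" "\<And>m. cmod (fourier_freq L m ^ (n+1) * z m) \<le> A"
  shows "(\<lambda>m::int. (1 + (real_of_int m)^2)^n * (cmod (z m))^2) summable_on UNIV"
    and "sqrt (L * (\<Sum>\<^sub>\<infinity>m::int. (1 + (real_of_int m)^2)^n * (cmod (z m))^2))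
      \<le> sqrt (L * hper_const L n * (\<Sum>\<^sub>\<infinity>m::int. 1 / (1 + (real_of_int m)^2))) * A"
proof -
  have A: "0 \<le> A" using assms(2)[of 0] norm_ge_zero order_trans by blast
  let ?w = "\<lambda>m::int. hper_const L n * A^2 * (1 / (1 + (real_of_int m)^2))"
  have w: "?w summable_on UNIV"
    by (intro summable_on_cmult_right summable_on_int_weight)
  have le: "(1 + (real_of_int m)^2)^n * (cmod (z m))^2 \<le> ?w m" for m
    using assms by (intro fourier_weight_le)
  show s: "(\<lambda>m::int. (1 + (real_of_int m)^2)^n * (cmod (z m))^2) summable_on UNIV"
    using le by (intro summable_on_comparison_test[OF w]) auto
  have "(\<Sum>\<^sub>\<infinity>m::int. (1 + (real_of_int m)^2)^n * (cmod (z m))^2) \<le> (\<Sum>\<^sub>\<infinity>m. ?w m)"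
    using le by (intro infsum_mono s w) auto
  also have "\<dots> = hper_const L n * A^2 * (\<Sum>\<^sub>\<infinity>m::int. 1 / (1 + (real_of_int m)^2))"
    by (rule infsum_cmult_right) (rule summable_on_int_weight)
  finally have "sqrt (L * (\<Sum>\<^sub>\<infinity>m::int. (1 + (real_of_int m)^2)^n * (cmod (z m))^2))
     \<le> sqrt (L * (hper_const L n * A^2 * (\<Sum>\<^sub>\<infinity>m::int. 1 / (1 + (real_of_int m)^2))))"
    using assms(1) by (intro real_sqrt_le_mono mult_left_mono) auto
  also have "\<dots> = sqrt ((L * hper_const L n * (\<Sum>\<^sub>\<infinity>m::int. 1 / (1 + (real_of_int m)^2))) * A^2)"
    by (simp add: mult_ac)
  also have "\<dots> = sqrt (L * hper_const L n * (\<Sum>\<^sub>\<infinity>m::int. 1 / (1 + (real_of_int m)^2))) * A"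
    using A by (simp only: real_sqrt_mult real_sqrt_abs abs_of_nonneg)
  finally show "sqrt (L * (\<Sum>\<^sub>\<infinity>m::int. (1 + (real_of_int m)^2)^n * (cmod (z m))^2))
      \<le> sqrt (L * hper_const L n * (\<Sum>\<^sub>\<infinity>m::int. 1 / (1 + (real_of_int m)^2))) * A" .
qed

section \<open>Families closed under differentiation\<close>

text \<open>The closure conditions make every member of \<open>S\<close> smooth in both variables.\<close>

locale smooth_family =
  fixes I :: "real set" and S :: "(real \<Rightarrow> real \<Rightarrow> real) set"
  assumes open_I: "open I"
    and cont: "f \<in> S \<Longrightarrow> continuous_on (I \<times> UNIV) (\<lambda>(\<omega>, x). f \<omega> x)"
    and ex_dw: "f \<in> S \<Longrightarrow> \<exists>g\<in>S. \<forall>\<omega>\<in>I. \<forall>x. ((\<lambda>\<omega>. f \<omega> x) has_real_derivative g \<omega> x) (at \<omega>)"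
    and ex_dx: "f \<in> S \<Longrightarrow> \<exists>g\<in>S. \<forall>\<omega>\<in>I. \<forall>x. (f \<omega> has_real_derivative g \<omega> x) (at x)"
begin

text \<open>A choice within \<open>S\<close>, so that the operator can be iterated there. On
  \<open>I\<close> the chosen function is the partial derivative; elsewhere its values are
  arbitrary.\<close>

definition dw :: "(real \<Rightarrow> real \<Rightarrow> real) \<Rightarrow> real \<Rightarrow> real \<Rightarrow> real" where
  "dw f = (SOME g. g \<in> S \<and> (\<forall>\<omega>\<in>I. \<forall>x. ((\<lambda>\<omega>. f \<omega> x) has_real_derivative g \<omega> x) (at \<omega>)))"

definition dx :: "(real \<Rightarrow> real \<Rightarrow> real) \<Rightarrow> real \<Rightarrow> real \<Rightarrow> real" where
  "dx f = (SOME g. g \<in> S \<and> (\<forall>\<omega>\<in>I. \<forall>x. (f \<omega> has_real_derivative g \<omega> x) (at x)))"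

lemma dw:
  assumes "f \<in> S"
  shows "dw f \<in> S" "\<omega> \<in> I \<Longrightarrow> ((\<lambda>\<omega>. f \<omega> x) has_real_derivative dw f \<omega> x) (at \<omega>)"
  using someI_ex[of "\<lambda>g. g \<in> S \<and> (\<forall>\<omega>\<in>I. \<forall>x. ((\<lambda>\<omega>. f \<omega> x) has_real_derivative g \<omega> x) (at \<omega>))"]
    ex_dw[OF assms] unfolding dw_def by blast+

lemma dx:
  assumes "f \<in> S"
  shows "dx f \<in> S" "\<omega> \<in> I \<Longrightarrow> (f \<omega> has_real_derivative dx f \<omega> x) (at x)"
  using someI_ex[of "\<lambda>g. g \<in> S \<and> (\<forall>\<omega>\<in>I. \<forall>x. (f \<omega> has_real_derivative g \<omega> x) (at x))"]
    ex_dx[OF assms] unfolding dx_def by blast+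

lemma dw_funpow: "f \<in> S \<Longrightarrow> (dw ^^ j) f \<in> S"
  by (induction j) (auto simp: dw)

lemma dx_funpow: "f \<in> S \<Longrightarrow> (dx ^^ j) f \<in> S"
  by (induction j) (auto simp: dx)

lemma continuous_x:
  assumes "f \<in> S" "\<omega> \<in> I" shows "continuous_on A (f \<omega>)"
  by (rule DERIV_continuous_on[OF has_field_derivative_at_within[OF dx(2)[OF assms]]])

text \<open>Kept apart from membership in \<open>S\<close>: the algebra used later contains the
  variable \<open>x\<close> and incomplete integrals.\<close>

definition x_periodic :: "real \<Rightarrow> (real \<Rightarrow> real \<Rightarrow> real) \<Rightarrow> bool" where
  "x_periodic L f \<longleftrightarrow> (\<forall>\<omega>\<in>I. \<forall>x. f \<omega> (x + L) = f \<omega> x)"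

lemma x_periodic_dx:
  assumes "f \<in> S" "x_periodic L f" shows "x_periodic L (dx f)"
  unfolding x_periodic_def
proof (intro ballI allI)
  fix \<omega> x assume w: "\<omega> \<in> I"
  have "((\<lambda>x. f \<omega> (x + L)) has_real_derivative dx f \<omega> (x + L)) (at x)"
    using dx(2)[OF assms(1) w, of "x + L"] by (simp add: DERIV_shift)
  moreover have "(\<lambda>x. f \<omega> (x + L)) = f \<omega>" using assms(2) w by (auto simp: x_periodic_def)
  ultimately show "dx f \<omega> (x + L) = dx f \<omega> x"
    using dx(2)[OF assms(1) w, of x] DERIV_unique by metis
qed

text \<open>As \<open>I\<close> is open, the functions at \<open>x + L\<close> and at
  \<open>x\<close> agree for all nearby frequencies.\<close>

lemma x_periodic_dw:
  assumes "f \<in> S" "x_periodic L f" shows "x_periodic L (dw f)"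
  unfolding x_periodic_def
proof (intro ballI allI)
  fix \<omega> x assume w: "\<omega> \<in> I"
  have "eventually (\<lambda>\<omega>. f \<omega> (x + L) = f \<omega> x) (nhds \<omega>)"
    using eventually_nhds_in_open[OF open_I w] assms(2) by (auto elim!: eventually_mono simp: x_periodic_def)
  then have "((\<lambda>\<omega>. f \<omega> (x + L)) has_real_derivative dw f \<omega> x) (at \<omega>)"
    using dw(2)[OF assms(1) w, of x] DERIV_cong_ev[OF refl _ refl, of "\<lambda>\<omega>. f \<omega> (x + L)" "\<lambda>\<omega>. f \<omega> x"] by simp
  then show "dw f \<omega> (x + L) = dw f \<omega> x"
    using dw(2)[OF assms(1) w, of "x + L"] DERIV_unique by blast
qed

lemma x_periodic_dw_funpow: "f \<in> S \<Longrightarrow> x_periodic L f \<Longrightarrow> x_periodic L ((dw ^^ j) f)"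
  by (induction j) (auto simp: x_periodic_dw dw_funpow)

lemma x_periodic_dx_funpow: "f \<in> S \<Longrightarrow> x_periodic L f \<Longrightarrow> x_periodic L ((dx ^^ j) f)"
  by (induction j) (auto simp: x_periodic_dx dx_funpow)

lemma fourier_coeff_dx_funpow:
  assumes "0 < L" "f \<in> S" "x_periodic L f" "\<omega> \<in> I"
  shows "fourier_coeff L ((dx ^^ r) f \<omega>) m = fourier_freq L m ^ r * fourier_coeff L (f \<omega>) m"
proof (induction r)
  case (Suc r)
  let ?g = "(dx ^^ r) f"
  have g: "?g \<in> S" "x_periodic L ?g" using assms by (auto simp: dx_funpow x_periodic_dx_funpow)
  then have "?g \<omega> (0 + L) = ?g \<omega> 0" using assms(4) unfolding x_periodic_def by blast
  then have "fourier_coeff L (dx ?g \<omega>) m = fourier_freq L m * fourier_coeff L (?g \<omega>) m"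
    using assms g by (intro fourier_coeff_deriv dx continuous_x) auto
  then show ?case using Suc by simp
qed simp

text \<open>A Taylor estimate of first order, uniform in \<open>x\<close>: the second frequency
  derivative is bounded on a compact rectangle, and the mean value inequality is applied twice, to
  \<open>dw f\<close> and then to \<open>f\<close> minus its linear part.\<close>

lemma diff_quotient_le:
  assumes "f \<in> S" "\<omega> \<in> I"
  shows "\<exists>B \<delta>. 0 \<le> B \<and> 0 < \<delta> \<and> (\<forall>\<nu>. \<bar>\<nu> - \<omega>\<bar> < \<delta> \<longrightarrow> \<nu> \<in> I) \<and>
    (\<forall>\<nu> x. \<bar>\<nu> - \<omega>\<bar> < \<delta> \<longrightarrow> \<nu> \<noteq> \<omega> \<longrightarrow> x \<in> {0..L} \<longrightarrow>
      \<bar>(f \<nu> x - f \<omega> x) / (\<nu> - \<omega>) - dw f \<omega> x\<bar> \<le> B * \<bar>\<nu> - \<omega>\<bar>)"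
proof -
  obtain \<delta> where \<delta>: "0 < \<delta>" "cball \<omega> \<delta> \<subseteq> I"
    using open_I assms(2) open_contains_cball by blast
  let ?g = "dw f" and ?h = "dw (dw f)"
  have S: "?g \<in> S" "?h \<in> S" using assms by (auto simp: dw)
  have "compact ((\<lambda>(\<omega>, x). ?h \<omega> x) ` (cball \<omega> \<delta> \<times> {0..L}))"
    using \<delta> by (intro compact_continuous_image continuous_on_subset[OF cont[OF S(2)]] compact_Times) auto
  then obtain B where B: "0 < B" "\<forall>y\<in>(\<lambda>(\<omega>, x). ?h \<omega> x) ` (cball \<omega> \<delta> \<times> {0..L}). norm y \<le> B"
    using compact_imp_bounded bounded_pos by blast
  then have hB: "\<bar>?h \<nu> x\<bar> \<le> B" if "\<nu> \<in> cball \<omega> \<delta>" "x \<in> {0..L}" for \<nu> x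
    using that by auto
  have gB: "\<bar>?g \<nu> x - ?g \<omega> x\<bar> \<le> B * \<bar>\<nu> - \<omega>\<bar>" if "\<nu> \<in> cball \<omega> \<delta>" "x \<in> {0..L}" for \<nu> x
  proof -
    have "norm (?g \<nu> x - ?g \<omega> x) \<le> B * norm (\<nu> - \<omega>)"
    proof (rule field_differentiable_bound[of "cball \<omega> \<delta>"])
      fix t assume t: "t \<in> cball \<omega> \<delta>"
      show "((\<lambda>\<nu>. ?g \<nu> x) has_real_derivative ?h t x) (at t within cball \<omega> \<delta>)"
        using t \<delta> by (intro has_field_derivative_at_within[OF dw(2)[OF S(1)]]) blast
      show "norm (?h t x) \<le> B" using hB[OF t that(2)] by simp
    qed (use that \<delta> in auto)
    then show ?thesis by simp
  qed
  show ?thesis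
  proof (rule exI[of _ B], rule exI[of _ \<delta>], intro conjI allI impI)
    show "\<nu> \<in> I" if "\<bar>\<nu> - \<omega>\<bar> < \<delta>" for \<nu>
      using \<delta> that by (auto simp: dist_real_def abs_minus_commute)
    fix \<nu> x assume \<nu>: "\<bar>\<nu> - \<omega>\<bar> < \<delta>" "\<nu> \<noteq> \<omega>" and x: "x \<in> {0..L}"
    \<comment> \<open>With a radius depending on \<nu>, the variation of \<open>dw f\<close> on the
      ball is itself of order \<open>\<bar>\<nu> - \<omega>\<bar>\<close>.\<close>
    let ?C = "cball \<omega> \<bar>\<nu> - \<omega>\<bar>"
    have C: "?C \<subseteq> cball \<omega> \<delta>" using \<nu> by (intro subset_cball) auto
    have "norm ((f \<nu> x - \<nu> * ?g \<omega> x) - (f \<omega> x - \<omega> * ?g \<omega> x)) \<le> (B * \<bar>\<nu> - \<omega>\<bar>) * norm (\<nu> - \<omega>)"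
    proof (rule field_differentiable_bound[of ?C])
      fix t assume t: "t \<in> ?C"
      then have "t \<in> I" using C \<delta> by blast
      then show "((\<lambda>\<nu>. f \<nu> x - \<nu> * ?g \<omega> x) has_real_derivative ?g t x - 1 * ?g \<omega> x) (at t within ?C)"
        by (intro DERIV_diff has_field_derivative_at_within[OF dw(2)[OF assms(1)]] DERIV_cmult_right DERIV_ident)
      have "\<bar>?g t x - ?g \<omega> x\<bar> \<le> B * \<bar>t - \<omega>\<bar>" using t C x by (intro gB) auto
      also have "\<dots> \<le> B * \<bar>\<nu> - \<omega>\<bar>" using t B by (intro mult_left_mono) (auto simp: dist_real_def)
      finally show "norm (?g t x - 1 * ?g \<omega> x) \<le> B * \<bar>\<nu> - \<omega>\<bar>" by simp
    qed (auto simp: dist_real_def)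
    also have "(f \<nu> x - \<nu> * ?g \<omega> x) - (f \<omega> x - \<omega> * ?g \<omega> x) = (\<nu> - \<omega>) * ((f \<nu> x - f \<omega> x) / (\<nu> - \<omega>) - ?g \<omega> x)"
    proof -
      have "(\<nu> - \<omega>) * ((f \<nu> x - f \<omega> x) / (\<nu> - \<omega>)) = f \<nu> x - f \<omega> x" using \<nu> by simp
      then show ?thesis unfolding right_diff_distrib[of "\<nu> - \<omega>"] by (simp add: algebra_simps)
    qed
    finally have "\<bar>\<nu> - \<omega>\<bar> * \<bar>(f \<nu> x - f \<omega> x) / (\<nu> - \<omega>) - ?g \<omega> x\<bar> \<le> \<bar>\<nu> - \<omega>\<bar> * (B * \<bar>\<nu> - \<omega>\<bar>)"
      by (simp only: real_norm_def abs_mult mult.commute)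
    then show "\<bar>(f \<nu> x - f \<omega> x) / (\<nu> - \<omega>) - ?g \<omega> x\<bar> \<le> B * \<bar>\<nu> - \<omega>\<bar>"
      using \<nu> by (simp only: mult_le_cancel_left_pos zero_less_abs_iff right_minus_eq not_False_eq_True)
  qed (use B \<delta> in auto)
qed

lemma continuous_diff_quotient:
  assumes "f \<in> S" "\<omega> \<in> I" "\<nu> \<in> I"
  shows "continuous_on A (\<lambda>x. (f \<nu> x - f \<omega> x) / (\<nu> - \<omega>) - dw f \<omega> x)"
  unfolding divide_inverse
  using assms by (intro continuous_intros continuous_x dw)

lemma fourier_coeff_diff_quotient_dw:
  assumes "f \<in> S" "\<omega> \<in> I" "\<nu> \<in> I"
  shows "fourier_coeff L (\<lambda>x. (f \<nu> x - f \<omega> x) / (\<nu> - \<omega>) - dw f \<omega> x) m =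
    (fourier_coeff L (f \<nu>) m - fourier_coeff L (f \<omega>) m) / of_real (\<nu> - \<omega>) - fourier_coeff L (dw f \<omega>) m"
  by (intro fourier_coeff_diff_quotient continuous_x dw assms)

lemma fourier_coeff_diff_quotient_le:
  assumes "0 < L" "f \<in> S" "\<omega> \<in> I"
  shows "\<exists>B \<delta>. 0 \<le> B \<and> 0 < \<delta> \<and> (\<forall>\<nu>. \<bar>\<nu> - \<omega>\<bar> < \<delta> \<longrightarrow> \<nu> \<in> I) \<and>
    (\<forall>\<nu> m. \<bar>\<nu> - \<omega>\<bar> < \<delta> \<longrightarrow> \<nu> \<noteq> \<omega> \<longrightarrow>
      cmod (fourier_coeff L (\<lambda>x. (f \<nu> x - f \<omega> x) / (\<nu> - \<omega>) - dw f \<omega> x) m) \<le> B * \<bar>\<nu> - \<omega>\<bar>)"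
proof -
  obtain B \<delta> where B: "0 \<le> B" "0 < \<delta>" "\<And>\<nu>. \<bar>\<nu> - \<omega>\<bar> < \<delta> \<Longrightarrow> \<nu> \<in> I"
    "\<And>\<nu> x. \<bar>\<nu> - \<omega>\<bar> < \<delta> \<Longrightarrow> \<nu> \<noteq> \<omega> \<Longrightarrow> x \<in> {0..L} \<Longrightarrow> \<bar>(f \<nu> x - f \<omega> x) / (\<nu> - \<omega>) - dw f \<omega> x\<bar> \<le> B * \<bar>\<nu> - \<omega>\<bar>"
    using diff_quotient_le[OF assms(2,3), of L] by blast
  show ?thesis
  proof (rule exI[of _ B], rule exI[of _ \<delta>], intro conjI allI impI)
    fix \<nu> m assume \<nu>: "\<bar>\<nu> - \<omega>\<bar> < \<delta>" "\<nu> \<noteq> \<omega>"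
    show "cmod (fourier_coeff L (\<lambda>x. (f \<nu> x - f \<omega> x) / (\<nu> - \<omega>) - dw f \<omega> x) m) \<le> B * \<bar>\<nu> - \<omega>\<bar>"
      by (intro cmod_fourier_coeff_le continuous_diff_quotient assms B \<nu>)
  qed (use B in auto)
qed

text \<open>The partial derivatives commute on the Fourier side: both sides of the identity below are
  limits of the same difference quotient.\<close>

lemma fourier_coeff_dw_dx_funpow:
  assumes "0 < L" "f \<in> S" "x_periodic L f" "\<omega> \<in> I"
  shows "fourier_coeff L (dw ((dx ^^ r) f) \<omega>) m = fourier_freq L m ^ r * fourier_coeff L (dw f \<omega>) m"
proof -
  let ?h = "(dx ^^ r) f" and ?c = "fourier_freq L m ^ r"
  let ?q = "\<lambda>f \<nu> m. fourier_coeff L (\<lambda>x. (f \<nu> x - f \<omega> x) / (\<nu> - \<omega>) - dw f \<omega> x) m"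
  let ?C = "?c * fourier_coeff L (dw f \<omega>) m - fourier_coeff L (dw ?h \<omega>) m"
  have h: "?h \<in> S" using assms by (simp add: dx_funpow)
  obtain B1 \<delta>1 where B1: "0 \<le> B1" "0 < \<delta>1" "\<And>\<nu>. \<bar>\<nu> - \<omega>\<bar> < \<delta>1 \<Longrightarrow> \<nu> \<in> I"
    "\<And>\<nu> m. \<bar>\<nu> - \<omega>\<bar> < \<delta>1 \<Longrightarrow> \<nu> \<noteq> \<omega> \<Longrightarrow> cmod (?q f \<nu> m) \<le> B1 * \<bar>\<nu> - \<omega>\<bar>"
    using fourier_coeff_diff_quotient_le[OF assms(1,2,4)] by blast
  obtain B2 \<delta>2 where B2: "0 \<le> B2" "0 < \<delta>2" "\<And>\<nu>. \<bar>\<nu> - \<omega>\<bar> < \<delta>2 \<Longrightarrow> \<nu> \<in> I"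
    "\<And>\<nu> m. \<bar>\<nu> - \<omega>\<bar> < \<delta>2 \<Longrightarrow> \<nu> \<noteq> \<omega> \<Longrightarrow> cmod (?q ?h \<nu> m) \<le> B2 * \<bar>\<nu> - \<omega>\<bar>"
    using fourier_coeff_diff_quotient_le[OF assms(1) h assms(4)] by blast
  have le: "cmod ?C \<le> (cmod ?c * B1 + B2) * \<bar>\<nu> - \<omega>\<bar>" if \<nu>: "\<bar>\<nu> - \<omega>\<bar> < min \<delta>1 \<delta>2" "\<nu> \<noteq> \<omega>" for \<nu>
  proof -
    have I: "\<nu> \<in> I" using B1 \<nu> by simp
    \<comment> \<open>The difference quotients cancel by \<open>fourier_coeff_dx_funpow\<close>.
      What remains does not depend on \<nu>, yet is of order
      \<open>\<bar>\<nu> - \<omega>\<bar>\<close>, hence 0.\<close>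
    have "?q ?h \<nu> m - ?c * ?q f \<nu> m = ?C"
      unfolding fourier_coeff_diff_quotient_dw[OF h assms(4) I] fourier_coeff_diff_quotient_dw[OF assms(2,4) I]
        fourier_coeff_dx_funpow[OF assms(1-3) I] fourier_coeff_dx_funpow[OF assms]
      by (simp add: right_diff_distrib diff_divide_distrib)
    then have "cmod ?C \<le> cmod (?q ?h \<nu> m) + cmod ?c * cmod (?q f \<nu> m)"
      using norm_triangle_ineq4[of "?q ?h \<nu> m" "?c * ?q f \<nu> m"] by (simp add: norm_mult)
    also have "\<dots> \<le> B2 * \<bar>\<nu> - \<omega>\<bar> + cmod ?c * (B1 * \<bar>\<nu> - \<omega>\<bar>)"
      using \<nu> B1 B2 by (intro add_mono mult_left_mono) auto
    finally show ?thesis by (simp add: algebra_simps)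
  qed
  have "((\<lambda>\<nu>. (cmod ?c * B1 + B2) * \<bar>\<nu> - \<omega>\<bar>) \<longlongrightarrow> (cmod ?c * B1 + B2) * \<bar>\<omega> - \<omega>\<bar>) (at \<omega>)"
    by (intro tendsto_intros)
  moreover have "eventually (\<lambda>\<nu>. cmod ?C \<le> (cmod ?c * B1 + B2) * \<bar>\<nu> - \<omega>\<bar>) (at \<omega>)"
    unfolding eventually_at using le B1(2) B2(2) by (intro exI[of _ "min \<delta>1 \<delta>2"]) (simp add: dist_real_def)
  ultimately have "cmod ?C \<le> (cmod ?c * B1 + B2) * \<bar>\<omega> - \<omega>\<bar>"
    by (intro tendsto_lowerbound) auto
  then show ?thesis by simp
qed

lemma mem_Hper:
  assumes "0 < L" "f \<in> S" "x_periodic L f" "\<omega> \<in> I"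
  shows "f \<omega> \<in> Hper L n"
proof -
  have sum: "(\<lambda>m::int. (1 + (real_of_int m)^2)^n * (cmod (fourier_coeff L (f \<omega>) m))^2) summable_on UNIV"
  proof -
    let ?g = "(dx ^^ (n+1)) f"
    have bdd: "\<exists>B. \<forall>x\<in>{0..L}. \<bar>h \<omega> x\<bar> \<le> B" if "h \<in> S" for h
      using compact_imp_bounded[OF compact_continuous_image[OF continuous_x[OF that assms(4)] compact_Icc[of 0 L]]]
      by (auto simp: bounded_iff)
    obtain B1 B2 where B1: "\<forall>x\<in>{0..L}. \<bar>f \<omega> x\<bar> \<le> B1" and B2: "\<forall>x\<in>{0..L}. \<bar>?g \<omega> x\<bar> \<le> B2"
      using bdd[OF assms(2)] bdd[OF dx_funpow[OF assms(2), of "n+1"]] by blast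
    show ?thesis
    proof (rule hper_weighted_sum(1)[OF assms(1), where A = "max B1 B2"])
      show "cmod (fourier_coeff L (f \<omega>) m) \<le> max B1 B2" for m
        using B1 assms by (intro cmod_fourier_coeff_le continuous_x) (auto simp: le_max_iff_disj)
      show "cmod (fourier_freq L m ^ (n+1) * fourier_coeff L (f \<omega>) m) \<le> max B1 B2" for m
        using B2 assms unfolding fourier_coeff_dx_funpow[OF assms, symmetric]
        by (intro cmod_fourier_coeff_le continuous_x dx_funpow) (auto simp: le_max_iff_disj)
    qed
  qed
  have "f \<omega> \<in> borel_measurable borel"
    using continuous_x[OF assms(2,4)] by (rule borel_measurable_continuous_onI)
  then have "f \<omega> \<in> borel_measurable lebesgue" by (simp add: measurable_completion)
  moreover have "set_integrable lebesgue {0..L} (\<lambda>x. (f \<omega> x)^2)"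
    by (intro absolutely_integrable_continuous_real continuous_intros continuous_x assms)
  ultimately show ?thesis
    using sum assms(3,4) by (simp add: Hper_def x_periodic_def)
qed

text \<open>Multiplying the coefficients of the remainder of \<open>f\<close> by the frequency to
  the power \<open>n + 1\<close> gives those of the remainder of \<open>(dx ^^ (n+1)) f\<close>,
  since the partial derivatives commute on the Fourier side. Both remainders are uniformly of order
  \<open>\<bar>\<nu> - \<omega>\<bar>\<close>.\<close>

lemma hper_norm_diff_quotient_tendsto:
  assumes "0 < L" "f \<in> S" "x_periodic L f" "\<omega> \<in> I"
  shows "((\<lambda>\<nu>. hper_norm L n (\<lambda>x. (f \<nu> x - f \<omega> x) / (\<nu> - \<omega>) - dw f \<omega> x)) \<longlongrightarrow> 0) (at \<omega> within I)"
proof -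
  let ?h = "(dx ^^ (n+1)) f"
  let ?q = "\<lambda>f \<nu> m. fourier_coeff L (\<lambda>x. (f \<nu> x - f \<omega> x) / (\<nu> - \<omega>) - dw f \<omega> x) m"
  let ?K = "sqrt (L * hper_const L n * (\<Sum>\<^sub>\<infinity>m::int. 1 / (1 + (real_of_int m)^2)))"
  have h: "?h \<in> S" using dx_funpow[OF assms(2)] .
  obtain B1 \<delta>1 where B1: "0 \<le> B1" "0 < \<delta>1" "\<And>\<nu>. \<bar>\<nu> - \<omega>\<bar> < \<delta>1 \<Longrightarrow> \<nu> \<in> I"
    "\<And>\<nu> m. \<bar>\<nu> - \<omega>\<bar> < \<delta>1 \<Longrightarrow> \<nu> \<noteq> \<omega> \<Longrightarrow> cmod (?q f \<nu> m) \<le> B1 * \<bar>\<nu> - \<omega>\<bar>"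
    using fourier_coeff_diff_quotient_le[OF assms(1,2,4)] by blast
  obtain B2 \<delta>2 where B2: "0 \<le> B2" "0 < \<delta>2" "\<And>\<nu>. \<bar>\<nu> - \<omega>\<bar> < \<delta>2 \<Longrightarrow> \<nu> \<in> I"
    "\<And>\<nu> m. \<bar>\<nu> - \<omega>\<bar> < \<delta>2 \<Longrightarrow> \<nu> \<noteq> \<omega> \<Longrightarrow> cmod (?q ?h \<nu> m) \<le> B2 * \<bar>\<nu> - \<omega>\<bar>"
    using fourier_coeff_diff_quotient_le[OF assms(1) h assms(4)] by blast
  have le: "hper_norm L n (\<lambda>x. (f \<nu> x - f \<omega> x) / (\<nu> - \<omega>) - dw f \<omega> x) \<le> ?K * ((B1 + B2) * \<bar>\<nu> - \<omega>\<bar>)"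
    if \<nu>: "\<bar>\<nu> - \<omega>\<bar> < min \<delta>1 \<delta>2" "\<nu> \<noteq> \<omega>" for \<nu>
    unfolding hper_norm_def
  proof (rule hper_weighted_sum(2)[OF assms(1)])
    fix m
    have I: "\<nu> \<in> I" using B1 \<nu> by simp
    have "cmod (?q f \<nu> m) \<le> B1 * \<bar>\<nu> - \<omega>\<bar>" using B1 \<nu> by simp
    also have "\<dots> \<le> (B1 + B2) * \<bar>\<nu> - \<omega>\<bar>" using B2 by (intro mult_right_mono) auto
    finally show "cmod (?q f \<nu> m) \<le> (B1 + B2) * \<bar>\<nu> - \<omega>\<bar>" .
    have "fourier_freq L m ^ (n+1) * ?q f \<nu> m = ?q ?h \<nu> m"
      unfolding fourier_coeff_diff_quotient_dw[OF h assms(4) I] fourier_coeff_diff_quotient_dw[OF assms(2,4) I]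
        fourier_coeff_dx_funpow[OF assms(1-3) I] fourier_coeff_dx_funpow[OF assms] fourier_coeff_dw_dx_funpow[OF assms]
      by (simp add: right_diff_distrib diff_divide_distrib del: power_Suc)
    then have "cmod (fourier_freq L m ^ (n+1) * ?q f \<nu> m) \<le> B2 * \<bar>\<nu> - \<omega>\<bar>" using B2 \<nu> by simp
    also have "\<dots> \<le> (B1 + B2) * \<bar>\<nu> - \<omega>\<bar>" using B1 by (intro mult_right_mono) auto
    finally show "cmod (fourier_freq L m ^ (n+1) * ?q f \<nu> m) \<le> (B1 + B2) * \<bar>\<nu> - \<omega>\<bar>" .
  qed
  show ?thesis
  proof (rule Lim_null_comparison)
    show "eventually (\<lambda>\<nu>. norm (hper_norm L n (\<lambda>x. (f \<nu> x - f \<omega> x) / (\<nu> - \<omega>) - dw f \<omega> x))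
        \<le> ?K * ((B1 + B2) * \<bar>\<nu> - \<omega>\<bar>)) (at \<omega> within I)"
      unfolding eventually_at
    proof (intro exI[of _ "min \<delta>1 \<delta>2"] conjI ballI impI)
      fix \<nu> assume "\<nu> \<noteq> \<omega> \<and> dist \<nu> \<omega> < min \<delta>1 \<delta>2"
      moreover have "0 \<le> hper_norm L n g" for g
        unfolding hper_norm_def using assms(1) by (intro real_sqrt_ge_zero mult_nonneg_nonneg infsum_nonneg) auto
      ultimately show "norm (hper_norm L n (\<lambda>x. (f \<nu> x - f \<omega> x) / (\<nu> - \<omega>) - dw f \<omega> x))
        \<le> ?K * ((B1 + B2) * \<bar>\<nu> - \<omega>\<bar>)"
        using le[of \<nu>] by (simp add: dist_real_def)
    qed (use B1 B2 in simp)
    have "((\<lambda>\<nu>. ?K * ((B1 + B2) * \<bar>\<nu> - \<omega>\<bar>)) \<longlongrightarrow> ?K * ((B1 + B2) * \<bar>\<omega> - \<omega>\<bar>)) (at \<omega> within I)"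
      by (intro tendsto_intros)
    then show "((\<lambda>\<nu>. ?K * ((B1 + B2) * \<bar>\<nu> - \<omega>\<bar>)) \<longlongrightarrow> 0) (at \<omega> within I)" by simp
  qed
qed

lemma smooth_Hper_curve:
  assumes "0 < L" "f \<in> S" "x_periodic L f" "\<And>\<omega>. \<omega> \<in> I \<Longrightarrow> f \<omega> = \<gamma> \<omega>"
  shows "smooth_Hper_curve L n I \<gamma>"
  unfolding smooth_Hper_curve_def
proof (intro exI[of _ "\<lambda>j. (dw ^^ j) f"] conjI allI ballI)
  show "(dw ^^ 0) f \<omega> = \<gamma> \<omega>" if "\<omega> \<in> I" for \<omega> using assms that by simp
  fix j \<omega> assume w: "\<omega> \<in> I"
  have j: "(dw ^^ j) f \<in> S" "x_periodic L ((dw ^^ j) f)"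
    using assms by (auto simp: dw_funpow x_periodic_dw_funpow)
  show "(dw ^^ j) f \<omega> \<in> Hper L n" by (rule mem_Hper[OF assms(1) j w])
  show "((\<lambda>\<nu>. hper_norm L n (\<lambda>x. ((dw ^^ j) f \<nu> x - (dw ^^ j) f \<omega> x) / (\<nu> - \<omega>) - (dw ^^ Suc j) f \<omega> x))
      \<longlongrightarrow> 0) (at \<omega> within I)"
    using hper_norm_diff_quotient_tendsto[OF assms(1) j w] by simp
qed

text \<open>The iterated \<open>deriv\<close> of \<gamma> and the iterated \<open>dw\<close> need
  agree only on \<open>I\<close>; openness of \<open>I\<close> carries the agreement to the next
  derivative.\<close>

lemma smooth_on_open:
  assumes "f \<in> S" "\<And>\<omega>. \<omega> \<in> I \<Longrightarrow> f \<omega> x = \<gamma> \<omega>"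
  shows "smooth_on_open I \<gamma>"
proof -
  have ev: "eventually (\<lambda>\<omega>. \<omega> \<in> I) (nhds \<omega>)" if "\<omega> \<in> I" for \<omega>
    using eventually_nhds_in_open[OF open_I that] .
  have *: "((deriv ^^ j) \<gamma> has_real_derivative (dw ^^ Suc j) f \<omega> x) (at \<omega>)"
    if "\<forall>\<omega>\<in>I. (deriv ^^ j) \<gamma> \<omega> = (dw ^^ j) f \<omega> x" "\<omega> \<in> I" for j \<omega>
  proof -
    have "eventually (\<lambda>\<omega>. (deriv ^^ j) \<gamma> \<omega> = (dw ^^ j) f \<omega> x) (nhds \<omega>)"
      using ev[OF that(2)] by eventually_elim (use that(1) in blast)
    then show ?thesis
      using dw(2)[OF dw_funpow[OF assms(1)] that(2), of j x] DERIV_cong_ev[OF refl _ refl] by fastforce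
  qed
  have eq: "\<forall>\<omega>\<in>I. (deriv ^^ j) \<gamma> \<omega> = (dw ^^ j) f \<omega> x" for j
  proof (induction j)
    case 0
    then show ?case using assms(2) by simp
  next
    case (Suc j)
    then show ?case using *[OF Suc.IH] by (auto intro: DERIV_imp_deriv)
  qed
  show ?thesis
    unfolding smooth_on_open_def using *[OF eq] by (auto simp: field_differentiable_def)
qed

end

section \<open>The algebra generated by the elliptic functions\<close>

text \<open>Polynomials in the generators with real coefficients. Reciprocals are not formed, so
  those that differentiation produces have to be generators themselves.\<close>

inductive_set gen_alg :: "(real \<Rightarrow> real \<Rightarrow> real) set \<Rightarrow> (real \<Rightarrow> real \<Rightarrow> real) set" for G where
  gen: "f \<in> G \<Longrightarrow> f \<in> gen_alg G"
| const: "(\<lambda>\<omega> x. c) \<in> gen_alg G"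
| add: "f \<in> gen_alg G \<Longrightarrow> g \<in> gen_alg G \<Longrightarrow> (\<lambda>\<omega> x. f \<omega> x + g \<omega> x) \<in> gen_alg G"
| mult: "f \<in> gen_alg G \<Longrightarrow> g \<in> gen_alg G \<Longrightarrow> (\<lambda>\<omega> x. f \<omega> x * g \<omega> x) \<in> gen_alg G"

lemma gen_alg_minus: "f \<in> gen_alg G \<Longrightarrow> (\<lambda>\<omega> x. - f \<omega> x) \<in> gen_alg G"
  using gen_alg.mult[OF gen_alg.const, of f G "-1"] by simp

lemma gen_alg_diff: "f \<in> gen_alg G \<Longrightarrow> g \<in> gen_alg G \<Longrightarrow> (\<lambda>\<omega> x. f \<omega> x - g \<omega> x) \<in> gen_alg G"
  using gen_alg.add[OF _ gen_alg_minus, of f G g] by simp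

lemma gen_alg_divide: "f \<in> gen_alg G \<Longrightarrow> (\<lambda>\<omega> x. f \<omega> x / c) \<in> gen_alg G"
  using gen_alg.mult[OF _ gen_alg.const, of f G "inverse c"] by (simp only: divide_inverse)

lemma gen_alg_power: "f \<in> gen_alg G \<Longrightarrow> (\<lambda>\<omega> x. f \<omega> x ^ n) \<in> gen_alg G"
  by (induction n) (auto intro: gen_alg.const gen_alg.mult)

lemmas gen_alg_intros = gen_alg.const gen_alg.add gen_alg.mult gen_alg_minus gen_alg_diff gen_alg_divide gen_alg_power

definition has_dw :: "real set \<Rightarrow> (real \<Rightarrow> real \<Rightarrow> real) set \<Rightarrow> (real \<Rightarrow> real \<Rightarrow> real) \<Rightarrow> bool" where
  "has_dw I A f \<longleftrightarrow> (\<exists>g\<in>A. \<forall>\<omega>\<in>I. \<forall>x. ((\<lambda>\<omega>. f \<omega> x) has_real_derivative g \<omega> x) (at \<omega>))"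

definition has_dx :: "real set \<Rightarrow> (real \<Rightarrow> real \<Rightarrow> real) set \<Rightarrow> (real \<Rightarrow> real \<Rightarrow> real) \<Rightarrow> bool" where
  "has_dx I A f \<longleftrightarrow> (\<exists>g\<in>A. \<forall>\<omega>\<in>I. \<forall>x. (f \<omega> has_real_derivative g \<omega> x) (at x))"

lemma has_dwI:
  "g \<in> A \<Longrightarrow> (\<And>\<omega> x. \<omega> \<in> I \<Longrightarrow> ((\<lambda>\<omega>. f \<omega> x) has_real_derivative g \<omega> x) (at \<omega>)) \<Longrightarrow> has_dw I A f"
  by (auto simp: has_dw_def)

lemma has_dxI:
  "g \<in> A \<Longrightarrow> (\<And>\<omega> x. \<omega> \<in> I \<Longrightarrow> (f \<omega> has_real_derivative g \<omega> x) (at x)) \<Longrightarrow> has_dx I A f"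
  by (auto simp: has_dx_def)

lemma has_dw_const: "has_dw I (gen_alg G) (\<lambda>\<omega> x. c)"
  by (rule has_dwI[OF gen_alg.const]) (rule DERIV_const)

lemma has_dx_const: "has_dx I (gen_alg G) (\<lambda>\<omega> x. c \<omega>)"
  by (rule has_dxI[OF gen_alg.const]) (rule DERIV_const)

lemma has_dw_add:
  assumes "has_dw I (gen_alg G) f" "has_dw I (gen_alg G) g"
  shows "has_dw I (gen_alg G) (\<lambda>\<omega> x. f \<omega> x + g \<omega> x)"
proof -
  obtain f' g' where "f' \<in> gen_alg G" "g' \<in> gen_alg G"
    "\<forall>\<omega>\<in>I. \<forall>x. ((\<lambda>\<omega>. f \<omega> x) has_real_derivative f' \<omega> x) (at \<omega>)"
    "\<forall>\<omega>\<in>I. \<forall>x. ((\<lambda>\<omega>. g \<omega> x) has_real_derivative g' \<omega> x) (at \<omega>)"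
    using assms unfolding has_dw_def by blast
  then show ?thesis
    by (intro has_dwI[of "\<lambda>\<omega> x. f' \<omega> x + g' \<omega> x"] gen_alg.add DERIV_add) blast+
qed

lemma has_dx_add:
  assumes "has_dx I (gen_alg G) f" "has_dx I (gen_alg G) g"
  shows "has_dx I (gen_alg G) (\<lambda>\<omega> x. f \<omega> x + g \<omega> x)"
proof -
  obtain f' g' where "f' \<in> gen_alg G" "g' \<in> gen_alg G"
    "\<forall>\<omega>\<in>I. \<forall>x. (f \<omega> has_real_derivative f' \<omega> x) (at x)"
    "\<forall>\<omega>\<in>I. \<forall>x. (g \<omega> has_real_derivative g' \<omega> x) (at x)"
    using assms unfolding has_dx_def by blast
  then show ?thesis
    by (intro has_dxI[of "\<lambda>\<omega> x. f' \<omega> x + g' \<omega> x"] gen_alg.add DERIV_add) blast+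
qed

lemma has_dw_mult:
  assumes "f \<in> gen_alg G" "g \<in> gen_alg G" "has_dw I (gen_alg G) f" "has_dw I (gen_alg G) g"
  shows "has_dw I (gen_alg G) (\<lambda>\<omega> x. f \<omega> x * g \<omega> x)"
proof -
  obtain f' g' where "f' \<in> gen_alg G" "g' \<in> gen_alg G"
    "\<forall>\<omega>\<in>I. \<forall>x. ((\<lambda>\<omega>. f \<omega> x) has_real_derivative f' \<omega> x) (at \<omega>)"
    "\<forall>\<omega>\<in>I. \<forall>x. ((\<lambda>\<omega>. g \<omega> x) has_real_derivative g' \<omega> x) (at \<omega>)"
    using assms(3,4) unfolding has_dw_def by blast
  then show ?thesis
    by (intro has_dwI[of "\<lambda>\<omega> x. f \<omega> x * g' \<omega> x + f' \<omega> x * g \<omega> x"] gen_alg.add gen_alg.mult DERIV_mult' assms) blast+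
qed

lemma has_dx_mult:
  assumes "f \<in> gen_alg G" "g \<in> gen_alg G" "has_dx I (gen_alg G) f" "has_dx I (gen_alg G) g"
  shows "has_dx I (gen_alg G) (\<lambda>\<omega> x. f \<omega> x * g \<omega> x)"
proof -
  obtain f' g' where "f' \<in> gen_alg G" "g' \<in> gen_alg G"
    "\<forall>\<omega>\<in>I. \<forall>x. (f \<omega> has_real_derivative f' \<omega> x) (at x)"
    "\<forall>\<omega>\<in>I. \<forall>x. (g \<omega> has_real_derivative g' \<omega> x) (at x)"
    using assms(3,4) unfolding has_dx_def by blast
  then show ?thesis
    by (intro has_dxI[of "\<lambda>\<omega> x. f \<omega> x * g' \<omega> x + f' \<omega> x * g \<omega> x"] gen_alg.add gen_alg.mult DERIV_mult' assms) blast+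
qed

text \<open>The derivative is a polynomial in the reciprocal and the derivative of \<open>f\<close>,
  so a reciprocal, once a generator, calls for no further one.\<close>

lemma has_dw_inverse:
  assumes "(\<lambda>\<omega> x. inverse (f \<omega> x)) \<in> gen_alg G" "has_dw I (gen_alg G) f" "\<And>\<omega> x. \<omega> \<in> I \<Longrightarrow> f \<omega> x \<noteq> 0"
  shows "has_dw I (gen_alg G) (\<lambda>\<omega> x. inverse (f \<omega> x))"
proof -
  obtain f' where "f' \<in> gen_alg G" "\<forall>\<omega>\<in>I. \<forall>x. ((\<lambda>\<omega>. f \<omega> x) has_real_derivative f' \<omega> x) (at \<omega>)"
    using assms(2) unfolding has_dw_def by blast
  then show ?thesis
    by (intro has_dwI[of "\<lambda>\<omega> x. - (inverse (f \<omega> x) * f' \<omega> x * inverse (f \<omega> x))"] gen_alg_minus gen_alg.mult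
        DERIV_inverse' assms) blast+
qed

lemma has_dx_inverse:
  assumes "(\<lambda>\<omega> x. inverse (f \<omega> x)) \<in> gen_alg G" "has_dx I (gen_alg G) f" "\<And>\<omega> x. \<omega> \<in> I \<Longrightarrow> f \<omega> x \<noteq> 0"
  shows "has_dx I (gen_alg G) (\<lambda>\<omega> x. inverse (f \<omega> x))"
proof -
  obtain f' where "f' \<in> gen_alg G" "\<forall>\<omega>\<in>I. \<forall>x. (f \<omega> has_real_derivative f' \<omega> x) (at x)"
    using assms(2) unfolding has_dx_def by blast
  then show ?thesis
    by (intro has_dxI[of "\<lambda>\<omega> x. - (inverse (f \<omega> x) * f' \<omega> x * inverse (f \<omega> x))"] gen_alg_minus gen_alg.mult
        DERIV_inverse' assms) blast+
qed

text \<open>Sum and product rule reduce closure under both derivatives to the generators.\<close>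

lemma smooth_family_gen_alg:
  assumes "open I"
    and cont: "\<And>f. f \<in> G \<Longrightarrow> continuous_on (I \<times> UNIV) (\<lambda>(\<omega>, x). f \<omega> x)"
    and dw: "\<And>f. f \<in> G \<Longrightarrow> has_dw I (gen_alg G) f"
    and dx: "\<And>f. f \<in> G \<Longrightarrow> has_dx I (gen_alg G) f"
  shows "smooth_family I (gen_alg G)"
proof
  show "open I" by fact
  show "continuous_on (I \<times> UNIV) (\<lambda>(\<omega>, x). f \<omega> x)" if "f \<in> gen_alg G" for f
    using that
  proof induction
    case (gen f)
    then show ?case by (rule cont)
  qed (auto simp: case_prod_unfold intro!: continuous_intros)
  have "has_dw I (gen_alg G) f" if "f \<in> gen_alg G" for f
    using that by induction (auto intro: dw has_dw_const has_dw_add has_dw_mult)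
  then show "\<exists>g\<in>gen_alg G. \<forall>\<omega>\<in>I. \<forall>x. ((\<lambda>\<omega>. f \<omega> x) has_real_derivative g \<omega> x) (at \<omega>)" if "f \<in> gen_alg G" for f
    using that unfolding has_dw_def by blast
  have "has_dx I (gen_alg G) f" if "f \<in> gen_alg G" for f
    using that by induction (auto intro: dx has_dx_const has_dx_add has_dx_mult)
  then show "\<exists>g\<in>gen_alg G. \<forall>\<omega>\<in>I. \<forall>x. (f \<omega> has_real_derivative g \<omega> x) (at x)" if "f \<in> gen_alg G" for f
    using that unfolding has_dx_def by blast
qed

text \<open>The argument is scaled by \<open>2 K / L = sqrt (d / 12)\<close>.\<close>

definition amp :: "real \<Rightarrow> real \<Rightarrow> real \<Rightarrow> real" where
  "amp L \<omega> x = ell_am (modulus L \<omega>) (2 * ellI 0 (modulus L \<omega>) (pi/2) * x / L)"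

text \<open>Closed under both derivatives up to polynomials. The frequency derivative of the
  amplitude brings in \<open>x\<close>, the complete integrals, \<open>ellI 1\<close> and the
  derivative of \<open>modulus\<close>; each \<open>ellI n\<close> calls for
  \<open>ellI (Suc n)\<close>, hence all \<open>n\<close>. The amplitude itself occurs only inside
  other functions.\<close>

inductive_set wave_gens :: "real \<Rightarrow> (real \<Rightarrow> real \<Rightarrow> real) set" for L where
  freq: "(\<lambda>\<omega> x. \<omega>) \<in> wave_gens L"
| var: "(\<lambda>\<omega> x. x) \<in> wave_gens L"
| parameter: "(\<lambda>\<omega> x. modulus L \<omega>) \<in> wave_gens L"
| dmodulus: "(\<lambda>\<omega> x. inverse (wave_freq' L (modulus L \<omega>))) \<in> wave_gens L"
| complete: "(\<lambda>\<omega> x. ellI n (modulus L \<omega>) (pi/2)) \<in> wave_gens L"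
| r: "(\<lambda>\<omega> x. wave_r (modulus L \<omega>)) \<in> wave_gens L"
| inv_r: "(\<lambda>\<omega> x. inverse (wave_r (modulus L \<omega>))) \<in> wave_gens L"
| sin: "(\<lambda>\<omega> x. sin (amp L \<omega> x)) \<in> wave_gens L"
| cos: "(\<lambda>\<omega> x. cos (amp L \<omega> x)) \<in> wave_gens L"
| Delta: "(\<lambda>\<omega> x. ellDelta (modulus L \<omega>) (amp L \<omega> x)) \<in> wave_gens L"
| inv_Delta: "(\<lambda>\<omega> x. inverse (ellDelta (modulus L \<omega>) (amp L \<omega> x))) \<in> wave_gens L"
| incomplete: "(\<lambda>\<omega> x. ellI n (modulus L \<omega>) (amp L \<omega> x)) \<in> wave_gens L"

abbreviation "wave_alg L \<equiv> gen_alg (wave_gens L)"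

lemmas wave_alg_intros = gen_alg_intros wave_gens.intros[THEN gen_alg.gen]

lemma wave_alg_ellG:
  "(\<lambda>\<omega> x. ellG n (modulus L \<omega>) (amp L \<omega> x)) \<in> wave_alg L"
proof -
  have "(\<lambda>\<omega> x. sin (amp L \<omega> x) ^ (2*n) * inverse (ellDelta (modulus L \<omega>) (amp L \<omega> x)) ^ (2*n+1)) \<in> wave_alg L"
    by (intro wave_alg_intros)
  then show ?thesis by (simp only: ellG_def divide_inverse power_inverse)
qed

section \<open>Derivatives of the generators over the half-line of frequencies\<close>

context
  fixes L :: real
  assumes L: "0 < L"
begin

abbreviation "freqs \<equiv> {4 * pi^2 / L^2 <..}"

lemma freqs_pos:
  assumes "\<omega> \<in> freqs" shows "0 < \<omega>"
proof -
  have "0 \<le> 4 * pi^2 / L^2" by simp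
  also have "\<dots> < \<omega>" using assms by (rule greaterThan_iff[THEN iffD1])
  finally show ?thesis .
qed

lemma modulus_range: "\<omega> \<in> freqs \<Longrightarrow> 0 < modulus L \<omega>" "\<omega> \<in> freqs \<Longrightarrow> modulus L \<omega> < 1"
  using modulus[of L \<omega>] L by auto

lemma modulus_has_deriv:
  "\<omega> \<in> freqs \<Longrightarrow> (modulus L has_real_derivative inverse (wave_freq' L (modulus L \<omega>))) (at \<omega>)"
  using modulus_deriv[of L \<omega>] L by auto

lemma wave_freq'_neq_0: "\<omega> \<in> freqs \<Longrightarrow> wave_freq' L (modulus L \<omega>) \<noteq> 0"
  using wave_freq'_pos[of "modulus L \<omega>" L] modulus_range[of \<omega>] L by auto

text \<open>The frequency acts through the scaling 2 K / L of the argument, which gives the term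
  with the explicit factor \<open>x\<close>, and through the parameter of the amplitude.\<close>

lemma amp_deriv_freq:
  assumes "\<omega> \<in> freqs"
  defines "m \<equiv> modulus L \<omega>" and "W \<equiv> inverse (wave_freq' L (modulus L \<omega>))"
  shows "((\<lambda>\<omega>. amp L \<omega> x) has_real_derivative
    ellDelta m (amp L \<omega> x) * (2 * ((real 0 + 1/2) * ellI (Suc 0) m (pi/2) * W) * x / L
      - ellI 1 m (amp L \<omega> x) / 2 * W)) (at \<omega>)"
  unfolding amp_def m_def W_def
  by (intro ell_am_chain modulus_has_deriv assms modulus_range DERIV_cdivide DERIV_cmult_right DERIV_cmult ellI_complete_chain)

lemma amp_deriv_var:
  assumes "\<omega> \<in> freqs"
  defines "m \<equiv> modulus L \<omega>"
  shows "(amp L \<omega> has_real_derivative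
    ellDelta m (amp L \<omega> x) * (2 * ellI 0 m (pi/2) / L)) (at x)"
proof -
  have "((\<lambda>x. 2 * ellI 0 m (pi/2) * x / L) has_real_derivative 2 * ellI 0 m (pi/2) / L) (at x)"
    using DERIV_cdivide[OF DERIV_cmult_Id] by blast
  from ell_am_chain[OF DERIV_const[of m] this] show ?thesis
    using modulus_range[OF assms(1)] by (simp add: amp_def[abs_def] m_def)
qed

lemma wave_gens_dw:
  assumes "f \<in> wave_gens L" shows "has_dw freqs (wave_alg L) f"
proof -
  let ?m = "modulus L"
  let ?W = "\<lambda>\<omega>. inverse (wave_freq' L (?m \<omega>))"
  let ?A = "\<lambda>\<omega> x. ellDelta (?m \<omega>) (amp L \<omega> x) * (2 * ((real 0 + 1/2) * ellI (Suc 0) (?m \<omega>) (pi/2) * ?W \<omega>) * x / L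
      - ellI 1 (?m \<omega>) (amp L \<omega> x) / 2 * ?W \<omega>)"
  have m: "has_dw freqs (wave_alg L) (\<lambda>\<omega> x. ?m \<omega>)"
    by (rule has_dwI[OF wave_gens.dmodulus[THEN gen_alg.gen]]) (rule modulus_has_deriv)
  have K: "has_dw freqs (wave_alg L) (\<lambda>\<omega> x. ellI n (?m \<omega>) (pi/2))" for n
    by (rule has_dwI[of "\<lambda>\<omega> x. (real n + 1/2) * ellI (Suc n) (?m \<omega>) (pi/2) * ?W \<omega>"])
       (intro wave_alg_intros ellI_complete_chain modulus_has_deriv modulus_range; assumption)+
  have r: "has_dw freqs (wave_alg L) (\<lambda>\<omega> x. wave_r (?m \<omega>))"
    by (rule has_dwI[of "\<lambda>\<omega> x. (2 * ?m \<omega> - 1) / 2 * inverse (wave_r (?m \<omega>)) * ?W \<omega>"])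
       (intro wave_alg_intros wave_r_chain modulus_has_deriv; assumption)+
  have ri: "has_dw freqs (wave_alg L) (\<lambda>\<omega> x. inverse (wave_r (?m \<omega>)))"
    by (intro has_dw_inverse r wave_alg_intros wave_r_neq_0)
  have W: "has_dw freqs (wave_alg L) (\<lambda>\<omega> x. ?W \<omega>)"
  proof (rule has_dw_inverse)
    \<comment> \<open>The square, difference and quotient in \<open>wave_freq'\<close> are rewritten
      into sums and products, for which closure rules are at hand.\<close>
    have "has_dw freqs (wave_alg L) (\<lambda>\<omega> x. 16 / L^2 * (ellI 0 (?m \<omega>) (pi/2) * ellI 1 (?m \<omega>) (pi/2) * wave_r (?m \<omega>)
       + ellI 0 (?m \<omega>) (pi/2) * ellI 0 (?m \<omega>) (pi/2) * ((?m \<omega> + (-1/2)) * inverse (wave_r (?m \<omega>)))))"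
      by (intro has_dw_mult has_dw_add has_dw_const wave_alg_intros m K r ri)
    also have "(\<lambda>\<omega> x. 16 / L^2 * (ellI 0 (?m \<omega>) (pi/2) * ellI 1 (?m \<omega>) (pi/2) * wave_r (?m \<omega>)
       + ellI 0 (?m \<omega>) (pi/2) * ellI 0 (?m \<omega>) (pi/2) * ((?m \<omega> + (-1/2)) * inverse (wave_r (?m \<omega>)))))
       = (\<lambda>\<omega> x. wave_freq' L (?m \<omega>))"
      by (simp add: wave_freq'_def power2_eq_square fun_eq_iff diff_divide_distrib mult.assoc)
    finally show "has_dw freqs (wave_alg L) (\<lambda>\<omega> x. wave_freq' L (?m \<omega>))" .
  qed (intro wave_alg_intros wave_freq'_neq_0; assumption)+
  have sin: "has_dw freqs (wave_alg L) (\<lambda>\<omega> x. sin (amp L \<omega> x))"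
    by (rule has_dwI[of "\<lambda>\<omega> x. cos (amp L \<omega> x) * ?A \<omega> x"], intro wave_alg_intros, rule DERIV_fun_sin, rule amp_deriv_freq)
  have cos: "has_dw freqs (wave_alg L) (\<lambda>\<omega> x. cos (amp L \<omega> x))"
    by (rule has_dwI[of "\<lambda>\<omega> x. - sin (amp L \<omega> x) * ?A \<omega> x"], intro wave_alg_intros, rule DERIV_fun_cos, rule amp_deriv_freq)
  have Delta: "has_dw freqs (wave_alg L) (\<lambda>\<omega> x. ellDelta (?m \<omega>) (amp L \<omega> x))"
  proof (rule has_dwI)
    show "(\<lambda>\<omega> x. - (?W \<omega> * (sin (amp L \<omega> x))^2 / 2 + ?m \<omega> * sin (amp L \<omega> x) * cos (amp L \<omega> x) * ?A \<omega> x)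
        * inverse (ellDelta (?m \<omega>) (amp L \<omega> x))) \<in> wave_alg L"
      by (intro wave_alg_intros)
    fix \<omega> x assume w: "\<omega> \<in> freqs"
    show "((\<lambda>\<omega>. ellDelta (?m \<omega>) (amp L \<omega> x)) has_real_derivative
        - (?W \<omega> * (sin (amp L \<omega> x))^2 / 2 + ?m \<omega> * sin (amp L \<omega> x) * cos (amp L \<omega> x) * ?A \<omega> x)
        * inverse (ellDelta (?m \<omega>) (amp L \<omega> x))) (at \<omega>)"
      using ellDelta_has_real_derivative[OF modulus_has_deriv[OF w] amp_deriv_freq[OF w] modulus_range(2)[OF w], of x]
      by (simp only: divide_inverse)
  qed
  have inv_Delta: "has_dw freqs (wave_alg L) (\<lambda>\<omega> x. inverse (ellDelta (?m \<omega>) (amp L \<omega> x)))"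
    by (rule has_dw_inverse[OF _ Delta]) (intro wave_alg_intros ellDelta_neq_0 modulus_range; assumption)+
  have inc: "has_dw freqs (wave_alg L) (\<lambda>\<omega> x. ellI n (?m \<omega>) (amp L \<omega> x))" for n
    by (rule has_dwI[of "\<lambda>\<omega> x. (real n + 1/2) * ellI (Suc n) (?m \<omega>) (amp L \<omega> x) * ?W \<omega> + ellG n (?m \<omega>) (amp L \<omega> x) * ?A \<omega> x"],
        intro wave_alg_intros wave_alg_ellG, rule ellI_chain, erule modulus_has_deriv, erule amp_deriv_freq, erule modulus_range)
  have freq: "has_dw freqs (wave_alg L) (\<lambda>\<omega> x. \<omega>)"
    by (rule has_dwI[OF gen_alg.const]) (rule DERIV_ident)
  have var: "has_dw freqs (wave_alg L) (\<lambda>\<omega> x. x)"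
    by (rule has_dwI[OF gen_alg.const]) (rule DERIV_const)
  from assms show ?thesis
    by cases (simp_all only: m K r ri W sin cos Delta inv_Delta inc freq var)
qed

lemma wave_gens_dx:
  assumes "f \<in> wave_gens L" shows "has_dx freqs (wave_alg L) f"
proof -
  let ?m = "modulus L"
  let ?A = "\<lambda>\<omega> x. ellDelta (?m \<omega>) (amp L \<omega> x) * (2 * ellI 0 (?m \<omega>) (pi/2) / L)"
  have sin: "has_dx freqs (wave_alg L) (\<lambda>\<omega> x. sin (amp L \<omega> x))"
    by (rule has_dxI[of "\<lambda>\<omega> x. cos (amp L \<omega> x) * ?A \<omega> x"], intro wave_alg_intros, rule DERIV_fun_sin, rule amp_deriv_var)
  have cos: "has_dx freqs (wave_alg L) (\<lambda>\<omega> x. cos (amp L \<omega> x))"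
    by (rule has_dxI[of "\<lambda>\<omega> x. - sin (amp L \<omega> x) * ?A \<omega> x"], intro wave_alg_intros, rule DERIV_fun_cos, rule amp_deriv_var)
  have Delta: "has_dx freqs (wave_alg L) (\<lambda>\<omega> x. ellDelta (?m \<omega>) (amp L \<omega> x))"
  proof (rule has_dxI)
    \<comment> \<open>The factor 0 is the derivative of the parameter, which is constant in
      \<open>x\<close>.\<close>
    show "(\<lambda>\<omega> x. - (0 * (sin (amp L \<omega> x))^2 / 2 + ?m \<omega> * sin (amp L \<omega> x) * cos (amp L \<omega> x) * ?A \<omega> x)
        * inverse (ellDelta (?m \<omega>) (amp L \<omega> x))) \<in> wave_alg L"
      by (intro wave_alg_intros)
    fix \<omega> x assume w: "\<omega> \<in> freqs"
    show "((\<lambda>x. ellDelta (?m \<omega>) (amp L \<omega> x)) has_real_derivative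
        - (0 * (sin (amp L \<omega> x))^2 / 2 + ?m \<omega> * sin (amp L \<omega> x) * cos (amp L \<omega> x) * ?A \<omega> x)
        * inverse (ellDelta (?m \<omega>) (amp L \<omega> x))) (at x)"
      using ellDelta_has_real_derivative[OF DERIV_const amp_deriv_var[OF w] modulus_range(2)[OF w], of x]
      by (simp only: divide_inverse)
  qed
  have inv_Delta: "has_dx freqs (wave_alg L) (\<lambda>\<omega> x. inverse (ellDelta (?m \<omega>) (amp L \<omega> x)))"
    by (rule has_dx_inverse[OF _ Delta]) (intro wave_alg_intros ellDelta_neq_0 modulus_range; assumption)+
  have inc: "has_dx freqs (wave_alg L) (\<lambda>\<omega> x. ellI n (?m \<omega>) (amp L \<omega> x))" for n
    by (rule has_dxI[of "\<lambda>\<omega> x. (real n + 1/2) * ellI (Suc n) (?m \<omega>) (amp L \<omega> x) * 0 + ellG n (?m \<omega>) (amp L \<omega> x) * ?A \<omega> x"],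
        intro wave_alg_intros wave_alg_ellG, rule ellI_chain, rule DERIV_const, erule amp_deriv_var, erule modulus_range)
  have var: "has_dx freqs (wave_alg L) (\<lambda>\<omega> x. x)"
    by (rule has_dxI[OF gen_alg.const]) (rule DERIV_ident)
  from assms show ?thesis
    by cases (simp_all only: has_dx_const sin cos Delta inv_Delta inc var)
qed

text \<open>Joint continuity, which the compactness argument of \<open>diff_quotient_le\<close>
  uses, does not follow from the existence of both partial derivatives. It rests on the joint
  continuity of \<open>ellI\<close> and \<open>ell_am\<close>.\<close>

lemma wave_gens_continuous:
  assumes "f \<in> wave_gens L" shows "continuous_on (freqs \<times> UNIV) (\<lambda>(\<omega>, x). f \<omega> x)"
proof -
  let ?D = "freqs \<times> (UNIV :: real set)"
  let ?m = "\<lambda>p :: real \<times> real. modulus L (fst p)"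
  have fs: "continuous_on ?D fst" "continuous_on ?D snd"
    by (rule continuous_on_fst[OF continuous_on_id], rule continuous_on_snd[OF continuous_on_id])
  have "continuous_on freqs (modulus L)"
    by (rule DERIV_continuous_on[OF has_field_derivative_at_within[OF modulus_has_deriv]])
  then have m: "continuous_on ?D ?m"
    by (rule continuous_on_compose2[OF _ fs(1)]) auto
  have m1: "?m p < 1" "0 < ?m p" if "p \<in> ?D" for p
    using that modulus_range[of "fst p"] by auto
  have K: "continuous_on ?D (\<lambda>p. ellI n (?m p) (pi/2))" for n
    by (intro continuous_on_ellI m continuous_on_const m1)
  have r: "continuous_on ?D (\<lambda>p. wave_r (?m p))" by (intro continuous_on_wave_r m)
  have ri: "continuous_on ?D (\<lambda>p. inverse (wave_r (?m p)))"
    by (intro continuous_on_inverse r ballI wave_r_neq_0)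
  have W: "continuous_on ?D (\<lambda>p. inverse (wave_freq' L (?m p)))"
  proof (intro continuous_on_inverse ballI)
    show "continuous_on ?D (\<lambda>p. wave_freq' L (?m p))"
      unfolding wave_freq'_def
      by (intro continuous_on_mult continuous_on_add continuous_on_diff continuous_on_power continuous_on_divide
          continuous_on_const K r ri m) simp
    show "wave_freq' L (?m p) \<noteq> 0" if "p \<in> ?D" for p
      using that by (intro wave_freq'_neq_0) auto
  qed
  have a: "continuous_on ?D (\<lambda>p. amp L (fst p) (snd p))"
    unfolding amp_def using L
    by (intro continuous_on_ell_am m m1 continuous_on_divide continuous_on_mult K continuous_on_const fs) simp_all
  have Delta: "continuous_on ?D (\<lambda>p. ellDelta (?m p) (amp L (fst p) (snd p)))"
    by (intro continuous_on_ellDelta m a)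
  have inv_Delta: "continuous_on ?D (\<lambda>p. inverse (ellDelta (?m p) (amp L (fst p) (snd p))))"
    by (intro continuous_on_inverse Delta ballI ellDelta_neq_0 m1)
  have inc: "continuous_on ?D (\<lambda>p. ellI n (?m p) (amp L (fst p) (snd p)))" for n
    by (intro continuous_on_ellI m a m1)
  have sc: "continuous_on ?D (\<lambda>p. sin (amp L (fst p) (snd p)))" "continuous_on ?D (\<lambda>p. cos (amp L (fst p) (snd p)))"
    by (intro continuous_on_sin continuous_on_cos a)+
  from assms show ?thesis
    unfolding case_prod_unfold
    by cases (simp_all only: fs m K r ri W Delta inv_Delta inc sc)
qed

lemma smooth_family_wave_alg: "smooth_family freqs (wave_alg L)"
  by (intro smooth_family_gen_alg open_greaterThan wave_gens_continuous wave_gens_dw wave_gens_dx)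

section \<open>The branch and the wave as members of the algebra\<close>

lemma cnoidal_wave_branch:
  assumes "\<omega> \<in> freqs"
  defines "m \<equiv> modulus L \<omega>" and "d \<equiv> 48 * (ellI 0 (modulus L \<omega>) (pi/2))^2 / L^2"
  shows "cnoidal_wave \<omega> (branch L \<omega>) = (\<lambda>x. \<omega> + d * (1 - 2 * m) / 3 + m * d * (cos (amp L \<omega> x))^2)"
proof -
  have w: "4 * pi^2 / L^2 < \<omega>" using assms by simp
  have w0: "0 < \<omega>" using assms(1) by (rule freqs_pos)
  note B = branch[OF L w]
  have "0 < ellI 0 m (pi/2)"
    unfolding m_def using modulus_range[OF assms(1)] by (intro ellI_complete_pos) auto
  then have "sqrt (d / 12) = 2 * ellI 0 m (pi/2) / L"
    using L by (intro real_sqrt_unique) (simp_all add: d_def m_def power_divide power_mult_distrib)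
  then have sq: "sqrt (d / 12) * x = 2 * ellI 0 m (pi/2) * x / L" for x by simp
  have "ksq \<omega> (branch L \<omega>) = m" "wave_gap \<omega> (branch L \<omega>) = d"
    using B by (simp_all add: m_def d_def)
  then show ?thesis
    by (simp only: cnoidal_wave_eq[OF w0 B(1,2)] amp_def m_def[symmetric] sq)
qed

lemma smooth_on_open_branch: "smooth_on_open freqs (branch L)"
proof -
  have "(\<lambda>\<omega> x. branch L \<omega>) \<in> wave_alg L"
    unfolding branch_def by (intro wave_alg_intros)
  then show ?thesis by (rule smooth_family.smooth_on_open[OF smooth_family_wave_alg]) simp
qed

lemma smooth_cnoidal_family_branch: "smooth_cnoidal_family L freqs (branch L)"
  unfolding smooth_cnoidal_family_def
proof (intro conjI ballI allI)
  fix \<omega> assume w: "\<omega> \<in> freqs"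
  have w0: "0 < \<omega>" using w by (rule freqs_pos)
  note B = branch[OF L, of \<omega>]
  show "2 * \<omega> < branch L \<omega>" "branch L \<omega> < 3 * \<omega>" using B w by auto
  then show "fundamental_period (cnoidal_wave \<omega> (branch L \<omega>)) L"
    "solves_profile_equation \<omega> (cnoidal_wave \<omega> (branch L \<omega>))"
    using w0 w L by (simp_all add: fundamental_period_iff_period_equation period_equation_iff_branch
        solves_profile_equation_cnoidal_wave)
next
  fix n
  let ?d = "\<lambda>\<omega>. 48 * (ellI 0 (modulus L \<omega>) (pi/2))^2 / L^2"
  let ?f = "\<lambda>\<omega> x. \<omega> + ?d \<omega> * (1 - 2 * modulus L \<omega>) / 3 + modulus L \<omega> * ?d \<omega> * (cos (amp L \<omega> x))^2"
  interpret smooth_family freqs "wave_alg L" by (rule smooth_family_wave_alg)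
  show "smooth_Hper_curve L n freqs (\<lambda>\<omega>. cnoidal_wave \<omega> (branch L \<omega>))"
  proof (rule smooth_Hper_curve[OF L])
    show "?f \<in> wave_alg L" by (intro wave_alg_intros)
    show eq: "?f \<omega> = cnoidal_wave \<omega> (branch L \<omega>)" if "\<omega> \<in> freqs" for \<omega>
      using cnoidal_wave_branch[OF that] by simp
    \<comment> \<open>Periodicity of the wave is read off from its fundamental period; the
      derivatives inherit it inside \<open>smooth_Hper_curve\<close>.\<close>
    have "fundamental_period (?f \<omega>) L" if w: "\<omega> \<in> freqs" for \<omega>
    proof -
      have w0: "0 < \<omega>" using w by (rule freqs_pos)
      show ?thesis
        unfolding eq[OF w] using branch[OF L, of \<omega>] w0 w L
        by (simp add: fundamental_period_iff_period_equation period_equation_iff_branch)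
    qed
    then show "x_periodic L ?f" unfolding x_periodic_def fundamental_period_def by blast
  qed
qed

end

theorem theorem2p1:
  fixes L \<omega>0 \<beta>30 :: real
  assumes "L > 0"
    and "\<omega>0 > 4 * pi^2 / L^2"
    and "2 * \<omega>0 < \<beta>30" and "\<beta>30 < 3 * \<omega>0"
    and "fundamental_period (cnoidal_wave \<omega>0 \<beta>30) L"
  shows "(\<exists>I B \<Gamma>. open_interval_around \<omega>0 I \<and> open_interval_around \<beta>30 B \<and>
            unique_smooth_branch L \<omega>0 \<beta>30 I B \<Gamma> \<and> smooth_cnoidal_family L I \<Gamma>) \<and>
         (\<exists>I B \<Gamma>. I = {4 * pi^2 / L^2 <..} \<and>
            open_interval_around \<omega>0 I \<and> open_interval_around \<beta>30 B \<and>
            unique_smooth_branch L \<omega>0 \<beta>30 I B \<Gamma> \<and> smooth_cnoidal_family L I \<Gamma>)"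
proof -
  let ?I = "{4 * pi^2 / L^2 <..}"
  have "\<beta>30 = branch L \<omega>0"
    using fundamental_period_iff_period_equation[of \<omega>0 \<beta>30 L] period_equation_iff_branch[of L \<omega>0 \<beta>30] assms
    by simp
  moreover have "period_equation L \<omega> \<beta> \<longleftrightarrow> \<beta> = branch L \<omega>" if "\<omega> \<in> ?I" for \<omega> \<beta>
    using period_equation_iff_branch[OF assms(1)] that by simp
  \<comment> \<open>The equation alone singles out the branch, so the whole line serves as
    \<open>B\<close>, and the half-line as \<open>I\<close> in both halves of the claim.\<close>
  ultimately have "unique_smooth_branch L \<omega>0 \<beta>30 ?I UNIV (branch L)"
    using smooth_on_open_branch[OF assms(1)]
    by (auto simp: unique_smooth_branch_def smooth_branch_def)
  moreover have "open_interval_around \<omega>0 ?I" "open_interval_around \<beta>30 UNIV"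
    using assms(2) by (simp_all add: open_interval_around_def is_interval_1)
  ultimately show ?thesis
    using smooth_cnoidal_family_branch[OF assms(1)] by blast
qed

end
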